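(* Let $\mathcal F$ be a family of subsets of Cantor space $2^\omega$ such that every $X\in\mathcal F$ is co-interval-free. Then there are programs $P_{\mathcal F}$ and $P^{-1}_{\mathcal F}$ such that for every sentence $\varphi$ of arithmetic and every program $p$: (i) if $p\Vdash\varphi$ then $P_{\mathcal F}(p,\varphi)\Vdash_{\mathcal F}\varphi$; (ii) if $p\Vdash_{\mathcal F}\varphi$ then $P^{-1}_{\mathcal F}(p,\varphi)\Vdash\varphi$. Consequently a sentence is realisable iff it is $\mathcal F$-realisable; in particular, for every sentence $\varphi$, $\varphi$ is Kleene realisable iff it is $\mathcal F_{\mathrm{cif}}$-realisable iff it is $\mathcal C$-realisable iff it is $\mathcal F_{=1}$-realisable.
   Context: Sentences are in the first-order language of arithmetic ($0,S,+,\cdot,=$). Programs are oracle Turing programs, identified with natural-number codes via a fixed computable enumeration; for a program $p$, oracle $u\in 2^\omega$ and $n\in\mathbb N$, $p^u(n)$ is the output of $p$ on input $n$ with oracle $u$. Ordinary programs are identified with oracle programs that never query the oracle, and for them $e(n)$ is the output on input $n$. For a program $p$ and $i\in\mathbb N$, $p(i)$ denotes the oracle program which, on oracle $u$, runs the program with code $p^u(i)$ on oracle $u$. Kleene realisability $e\Vdash\varphi$: never $e\Vdash\bot$; $e\Vdash t=s$ iff $t,s$ have the same value in $\mathbb N$; $e\Vdash\psi_0\wedge\psi_1$ iff $e(i)\Vdash\psi_i$ for $i<2$; $e\Vdash\psi_0\vee\psi_1$ iff $e(0)=i<2$ and $e(1)\Vdash\psi_i$; $e\Vdash\varphi\to\psi$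 iff for every $s\Vdash\varphi$, $e(s)\Vdash\psi$; $e\Vdash\exists x\varphi(x)$ iff $e(0)=n$ and $e(1)\Vdash\varphi(n)$; $e\Vdash\forall x\varphi(x)$ iff $e(n)\Vdash\varphi(n)$ for all $n$ (outputs mentioned must exist). A sentence is realisable if it has a realiser. For a family $\mathcal F$ of subsets of $2^\omega$, $\mathcal F$-realisability $p\Vdash_{\mathcal F}\varphi$ is defined by recursion: never $p\Vdash_{\mathcal F}\bot$; $p\Vdash_{\mathcal F}t=s$ iff $t,s$ have the same value; $p\Vdash_{\mathcal F}\psi_0\wedge\psi_1$ iff $p(i)\Vdash_{\mathcal F}\psi_i$ for $i<2$; $p\Vdash_{\mathcal F}\psi_0\vee\psi_1$ iff there are $O\in\mathcal F$ and $i<2$ such that for all $u\in O$, $p^u(0)=i$ and $p^u(1)\Vdash_{\mathcal F}\psi_i$; $p\Vdash_{\mathcal F}\varphi\to\psi$ iff there is $O\in\mathcal F$ such that for all $u\in O$ and all $s\Vdash_{\mathcal F}\varphi$, $p^u(s)\Vdash_{\mathcal F}\psi$; $p\Vdash_{\mathcal F}\exists x\varphi$ iff there are $O\in\mathcal F$ and $n$ such that for all $u\in O$, $p^u(0)=n$ and $p^u(1)\Vdash_{\mathcal F}\varphi(n)$; $p\Vdash_{\mathcal F}\forall x\varphi$ iff there is $O\in\mathcal F$ such that for all $u\in O$ and all $n$, $p^u(n)\Vdash_{\mathcal F}\varphi(n)$. $\varphi$ is $\mathcal F$-realisable if some $p\Vdash_{\mathcal F}\varphi$. For a finite binary string $s$,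 $N_s=\{v\in2^\omega: s\subset v\}$. A set $Y\subseteq2^\omega$ is interval-free if it contains no $N_s$; $X$ is co-interval-free if $2^\omega\setminus X$ is interval-free. $\mathcal F_{\mathrm{cif}}$ is the family of co-interval-free subsets of $2^\omega$, $\mathcal C$ the family of comeagre subsets, and $\mathcal F_{=1}$ the family of subsets of Lebesgue measure $1$.
   Formalization: The family F is assumed nonempty: for the empty family the claim fails, since 0=0 ∨ 0=0 is Kleene realisable, while the clause for ∨ in F-realisability requires some O in F. *)

theory Defs
  imports "HOL-Probability.Probability" "HOL-Library.Nat_Bijection"
begin

section \<open>Sentences of arithmetic\<close>

datatype tm = Var nat | Zero | Succ tm | Plus tm tm | Times tm tm

datatype fm =
    Falsum
  | Equ tm tm
  | Conj fm fm
  | Disj fm fm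
  | Impl fm fm
  | Exists nat fm
  | Forall nat fm

primrec tm_vars :: "tm \<Rightarrow> nat set" where
  "tm_vars (Var x) = {x}"
| "tm_vars Zero = {}"
| "tm_vars (Succ t) = tm_vars t"
| "tm_vars (Plus t s) = tm_vars t \<union> tm_vars s"
| "tm_vars (Times t s) = tm_vars t \<union> tm_vars s"

primrec free_vars :: "fm \<Rightarrow> nat set" where
  "free_vars Falsum = {}"
| "free_vars (Equ t s) = tm_vars t \<union> tm_vars s"
| "free_vars (Conj \<phi> \<psi>) = free_vars \<phi> \<union> free_vars \<psi>"
| "free_vars (Disj \<phi> \<psi>) = free_vars \<phi> \<union> free_vars \<psi>"
| "free_vars (Impl \<phi> \<psi>) = free_vars \<phi> \<union> free_vars \<psi>"
| "free_vars (Exists x \<phi>) = free_vars \<phi> - {x}"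
| "free_vars (Forall x \<phi>) = free_vars \<phi> - {x}"

definition sentence :: "fm \<Rightarrow> bool" where
  "sentence \<phi> \<longleftrightarrow> free_vars \<phi> = {}"

(* Only closed terms are ever evaluated; the value of a variable is a dummy. *)
primrec tm_val :: "tm \<Rightarrow> nat" where
  "tm_val (Var x) = 0"
| "tm_val Zero = 0"
| "tm_val (Succ t) = Suc (tm_val t)"
| "tm_val (Plus t s) = tm_val t + tm_val s"
| "tm_val (Times t s) = tm_val t * tm_val s"

definition numeral_tm :: "nat \<Rightarrow> tm" where
  "numeral_tm n = (Succ ^^ n) Zero"

primrec tm_inst :: "nat \<Rightarrow> nat \<Rightarrow> tm \<Rightarrow> tm" where
  "tm_inst x n (Var y) = (if y = x then numeral_tm n else Var y)"
| "tm_inst x n Zero = Zero"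
| "tm_inst x n (Succ t) = Succ (tm_inst x n t)"
| "tm_inst x n (Plus t s) = Plus (tm_inst x n t) (tm_inst x n s)"
| "tm_inst x n (Times t s) = Times (tm_inst x n t) (tm_inst x n s)"

(* inst x n \<phi> replaces the free occurrences of x by the numeral of n.  Numerals are
   closed, so no variable can be captured. *)
primrec inst :: "nat \<Rightarrow> nat \<Rightarrow> fm \<Rightarrow> fm" where
  "inst x n Falsum = Falsum"
| "inst x n (Equ t s) = Equ (tm_inst x n t) (tm_inst x n s)"
| "inst x n (Conj \<phi> \<psi>) = Conj (inst x n \<phi>) (inst x n \<psi>)"
| "inst x n (Disj \<phi> \<psi>) = Disj (inst x n \<phi>) (inst x n \<psi>)"
| "inst x n (Impl \<phi> \<psi>) = Impl (inst x n \<phi>) (inst x n \<psi>)"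
| "inst x n (Exists y \<phi>) = Exists y (if y = x then \<phi> else inst x n \<phi>)"
| "inst x n (Forall y \<phi>) = Forall y (if y = x then \<phi> else inst x n \<phi>)"

primrec tm_code :: "tm \<Rightarrow> nat" where
  "tm_code (Var x) = prod_encode (0, x)"
| "tm_code Zero = prod_encode (1, 0)"
| "tm_code (Succ t) = prod_encode (2, tm_code t)"
| "tm_code (Plus t s) = prod_encode (3, prod_encode (tm_code t, tm_code s))"
| "tm_code (Times t s) = prod_encode (4, prod_encode (tm_code t, tm_code s))"

primrec fm_code :: "fm \<Rightarrow> nat" where
  "fm_code Falsum = prod_encode (0, 0)"
| "fm_code (Equ t s) = prod_encode (1, prod_encode (tm_code t, tm_code s))"
| "fm_code (Conj \<phi> \<psi>) = prod_encode (2, prod_encode (fm_code \<phi>, fm_code \<psi>))"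
| "fm_code (Disj \<phi> \<psi>) = prod_encode (3, prod_encode (fm_code \<phi>, fm_code \<psi>))"
| "fm_code (Impl \<phi> \<psi>) = prod_encode (4, prod_encode (fm_code \<phi>, fm_code \<psi>))"
| "fm_code (Exists x \<phi>) = prod_encode (5, prod_encode (x, fm_code \<phi>))"
| "fm_code (Forall x \<phi>) = prod_encode (6, prod_encode (x, fm_code \<phi>))"

lemma tm_code_inject: "tm_code t = tm_code s \<Longrightarrow> t = s"
  by (induction t arbitrary: s; case_tac s; simp)

lemma fm_code_inject: "fm_code \<phi> = fm_code \<psi> \<Longrightarrow> \<phi> = \<psi>"
  by (induction \<phi> arbitrary: \<psi>; case_tac \<psi>; simp add: tm_code_inject)


section \<open>Oracle Turing programs\<close>

type_synonym cantor = "nat \<Rightarrow> bool"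

(* Quadruple machines in the style of Davis, Computability and Unsolvability: one two-way
   infinite tape, symbols and states are natural numbers, symbol 0 is blank.  The last
   argument(s) of an action are the next state(s).  Query asks whether the number of 1s
   currently on the tape belongs to the oracle. *)
datatype action = MoveL nat | MoveR nat | Write nat nat | Query nat nat

(* An entry ((q, a), act) applies in state q when symbol a is scanned; if several entries
   have the same key, the first one counts. *)
type_synonym program = "((nat \<times> nat) \<times> action) list"

(* (q, l, r): state, tape to the left of the head (nearest cell first), tape from the
   scanned cell to the right; all further cells are blank. *)
type_synonym config = "nat \<times> nat list \<times> nat list"

definition scanned :: "nat list \<Rightarrow> nat" where
  "scanned r = (case r of [] \<Rightarrow> 0 | a # _ \<Rightarrow> a)"

fun ones :: "config \<Rightarrow> nat" where
  "ones (q, l, r) = count_list l 1 + count_list r 1"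

fun perform :: "cantor \<Rightarrow> action \<Rightarrow> config \<Rightarrow> config" where
  "perform u (MoveL q') (q, l, r) = (q', tl l, scanned l # r)"
| "perform u (MoveR q') (q, l, r) = (q', scanned r # l, tl r)"
| "perform u (Write a q') (q, l, r) = (q', l, a # tl r)"
| "perform u (Query q\<^sub>1 q\<^sub>2) (q, l, r) = (if u (ones (q, l, r)) then q\<^sub>1 else q\<^sub>2, l, r)"

fun step :: "program \<Rightarrow> cantor \<Rightarrow> config \<Rightarrow> config option" where
  "step M u (q, l, r) =
     map_option (\<lambda>act. perform u act (q, l, r)) (map_of M (q, scanned r))"

partial_function (option) exec :: "(config \<Rightarrow> config option) \<Rightarrow> config \<Rightarrow> nat option" where
  "exec f c = (case f c of None \<Rightarrow> Some (ones c) | Some c' \<Rightarrow> exec f c')"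

fun action_of :: "nat \<times> nat \<Rightarrow> action" where
  "action_of (k, m) =
     (if k = 0 then MoveL m
      else if k = 1 then MoveR m
      else let (i, j) = prod_decode m in if k = 2 then Write i j else Query i j)"

(* Every natural number codes a program and every program has a code. *)
definition program_of :: "nat \<Rightarrow> program" where
  "program_of p =
     map (\<lambda>c. let (k, a) = prod_decode c in (prod_decode k, action_of (prod_decode a)))
       (list_decode p)"

(* run p u n is the value, if any, of the program with code p on input n with oracle u:
   the machine starts in state 0 on the leftmost of n + 1 ones on an otherwise blank tape,
   and the output is the number of ones on the tape when it halts. *)
definition run :: "nat \<Rightarrow> cantor \<Rightarrow> nat \<Rightarrow> nat option" where
  "run p u n = exec (step (program_of p) u) (0, [], replicate (Suc n) 1)"

definition ordinary :: "nat \<Rightarrow> bool" where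
  "ordinary p \<longleftrightarrow> (\<forall>(k, act) \<in> set (program_of p). \<forall>q\<^sub>1 q\<^sub>2. act \<noteq> Query q\<^sub>1 q\<^sub>2)"

(* Meant for ordinary programs, where the choice of the oracle is irrelevant. *)
definition run_ordinary :: "nat \<Rightarrow> nat \<Rightarrow> nat option" where
  "run_ordinary e n = run e (\<lambda>_. False) n"

lemma surj_program_of: "surj program_of"
proof -
  have act: "\<exists>m. action_of (prod_decode m) = act" for act
  proof (cases act)
    case (MoveL q)
    then show ?thesis by (intro exI[of _ "prod_encode (0, q)"]) simp
  next
    case (MoveR q)
    then show ?thesis by (intro exI[of _ "prod_encode (1, q)"]) simp
  next
    case (Write a q)
    then show ?thesis by (intro exI[of _ "prod_encode (2, prod_encode (a, q))"]) simp
  next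
    case (Query q q')
    then show ?thesis by (intro exI[of _ "prod_encode (3, prod_encode (q, q'))"]) simp
  qed
  have "\<exists>p. program_of p = M" for M
  proof (induction M)
    case Nil
    show ?case by (intro exI[of _ "list_encode []"]) (simp add: program_of_def)
  next
    case (Cons x M)
    then obtain p where p: "program_of p = M" by blast
    obtain k a where x: "x = (k, a)" by fastforce
    obtain m where m: "action_of (prod_decode m) = a" using act by blast
    show ?case
      using p m x
      by (intro exI[of _ "list_encode (prod_encode (prod_encode k, m) # list_decode p)"])
        (simp add: program_of_def)
  qed
  then show ?thesis unfolding surj_def by metis
qed

lemma run_ordinary_eq_run:
  assumes "ordinary e"
  shows "run_ordinary e n = run e u n"
proof -
  have "perform v act c = perform w act c" if "\<forall>q\<^sub>1 q\<^sub>2. act \<noteq> Query q\<^sub>1 q\<^sub>2" for v w act c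
    using that by (cases act; cases c; simp)
  moreover have "\<forall>q\<^sub>1 q\<^sub>2. act \<noteq> Query q\<^sub>1 q\<^sub>2" if "map_of (program_of e) k = Some act" for k act
    using assms that by (fastforce simp: ordinary_def dest: map_of_SomeD)
  ultimately have "step (program_of e) v c = step (program_of e) w c" for v w c
    by (cases c) (auto intro!: option.map_cong0 simp: option.set_sel elim!: option.set_cases)
  then have "step (program_of e) (\<lambda>_. False) = step (program_of e) u" by blast
  then show ?thesis by (simp add: run_ordinary_def run_def)
qed


section \<open>Realisability\<close>

primrec depth :: "fm \<Rightarrow> nat" where
  "depth Falsum = 0"
| "depth (Equ t s) = 0"
| "depth (Conj \<phi> \<psi>) = Suc (depth \<phi> + depth \<psi>)"
| "depth (Disj \<phi> \<psi>) = Suc (depth \<phi> + depth \<psi>)"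
| "depth (Impl \<phi> \<psi>) = Suc (depth \<phi> + depth \<psi>)"
| "depth (Exists x \<phi>) = Suc (depth \<phi>)"
| "depth (Forall x \<phi>) = Suc (depth \<phi>)"

lemma depth_inst [simp]: "depth (inst x n \<phi>) = depth \<phi>"
  by (induction \<phi>) auto

(* Kleene realisers are ordinary programs, whence the guards. *)
function realises :: "nat \<Rightarrow> fm \<Rightarrow> bool" where
  "realises e Falsum \<longleftrightarrow> False"
| "realises e (Equ t s) \<longleftrightarrow> ordinary e \<and> tm_val t = tm_val s"
| "realises e (Conj \<phi> \<psi>) \<longleftrightarrow> ordinary e \<and>
     (\<exists>e'. run_ordinary e 0 = Some e' \<and> realises e' \<phi>) \<and>
     (\<exists>e'. run_ordinary e 1 = Some e' \<and> realises e' \<psi>)"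
| "realises e (Disj \<phi> \<psi>) \<longleftrightarrow> ordinary e \<and>
     (\<exists>i<2. run_ordinary e 0 = Some i \<and>
        (\<exists>e'. run_ordinary e 1 = Some e' \<and> (if i = 0 then realises e' \<phi> else realises e' \<psi>)))"
| "realises e (Impl \<phi> \<psi>) \<longleftrightarrow> ordinary e \<and>
     (\<forall>s. realises s \<phi> \<longrightarrow> (\<exists>e'. run_ordinary e s = Some e' \<and> realises e' \<psi>))"
| "realises e (Exists x \<phi>) \<longleftrightarrow> ordinary e \<and>
     (\<exists>n. run_ordinary e 0 = Some n \<and>
        (\<exists>e'. run_ordinary e 1 = Some e' \<and> realises e' (inst x n \<phi>)))"
| "realises e (Forall x \<phi>) \<longleftrightarrow> ordinary e \<and>
     (\<forall>n. \<exists>e'. run_ordinary e n = Some e' \<and> realises e' (inst x n \<phi>))"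
  by pat_completeness auto
termination by (relation "Wellfounded.measure (\<lambda>(e, \<phi>). depth \<phi>)") auto

definition realisable :: "fm \<Rightarrow> bool" where
  "realisable \<phi> \<longleftrightarrow> (\<exists>e. realises e \<phi>)"

(* run p is the behaviour of the oracle program p. *)
type_synonym behaviour = "cantor \<Rightarrow> nat \<Rightarrow> nat option"

(* The behaviour of p(i), if f is that of p. *)
definition select :: "behaviour \<Rightarrow> nat \<Rightarrow> behaviour" where
  "select f i = (\<lambda>u n. Option.bind (f u i) (\<lambda>e. run e u n))"

(* Every clause depends on the realising program only through its behaviour, so the
   recursion is over behaviours; this avoids having to fix a code for the program p(i) in
   the clause for conjunction. *)
function F_realises_beh :: "cantor set set \<Rightarrow> behaviour \<Rightarrow> fm \<Rightarrow> bool" where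
  "F_realises_beh F f Falsum \<longleftrightarrow> False"
| "F_realises_beh F f (Equ t s) \<longleftrightarrow> tm_val t = tm_val s"
| "F_realises_beh F f (Conj \<phi> \<psi>) \<longleftrightarrow>
     F_realises_beh F (select f 0) \<phi> \<and> F_realises_beh F (select f 1) \<psi>"
| "F_realises_beh F f (Disj \<phi> \<psi>) \<longleftrightarrow>
     (\<exists>X\<in>F. \<exists>i<2. \<forall>u\<in>X. f u 0 = Some i \<and>
        (\<exists>q. f u 1 = Some q \<and>
           (if i = 0 then F_realises_beh F (run q) \<phi> else F_realises_beh F (run q) \<psi>)))"
| "F_realises_beh F f (Impl \<phi> \<psi>) \<longleftrightarrow>
     (\<exists>X\<in>F. \<forall>u\<in>X. \<forall>s. F_realises_beh F (run s) \<phi> \<longrightarrow>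
        (\<exists>q. f u s = Some q \<and> F_realises_beh F (run q) \<psi>))"
| "F_realises_beh F f (Exists x \<phi>) \<longleftrightarrow>
     (\<exists>X\<in>F. \<exists>n. \<forall>u\<in>X. f u 0 = Some n \<and>
        (\<exists>q. f u 1 = Some q \<and> F_realises_beh F (run q) (inst x n \<phi>)))"
| "F_realises_beh F f (Forall x \<phi>) \<longleftrightarrow>
     (\<exists>X\<in>F. \<forall>u\<in>X. \<forall>n. \<exists>q. f u n = Some q \<and> F_realises_beh F (run q) (inst x n \<phi>))"
  by pat_completeness auto
termination by (relation "Wellfounded.measure (\<lambda>(F, f, \<phi>). depth \<phi>)") auto

definition F_realises :: "cantor set set \<Rightarrow> nat \<Rightarrow> fm \<Rightarrow> bool" where
  "F_realises F p \<phi> \<longleftrightarrow> F_realises_beh F (run p) \<phi>"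

definition F_realisable :: "cantor set set \<Rightarrow> fm \<Rightarrow> bool" where
  "F_realisable F \<phi> \<longleftrightarrow> (\<exists>p. F_realises F p \<phi>)"


section \<open>Families of subsets of Cantor space\<close>

definition cylinder :: "bool list \<Rightarrow> cantor set" where
  "cylinder s = {v. \<forall>i<length s. v i = s ! i}"

definition interval_free :: "cantor set \<Rightarrow> bool" where
  "interval_free Y \<longleftrightarrow> \<not> (\<exists>s. cylinder s \<subseteq> Y)"

definition co_interval_free :: "cantor set \<Rightarrow> bool" where
  "co_interval_free X \<longleftrightarrow> interval_free (- X)"

definition nowhere_dense :: "'a::topological_space set \<Rightarrow> bool" where
  "nowhere_dense A \<longleftrightarrow> interior (closure A) = {}"

definition meagre :: "'a::topological_space set \<Rightarrow> bool" where
  "meagre A \<longleftrightarrow> (\<exists>B :: nat \<Rightarrow> 'a set. (\<forall>n. nowhere_dense (B n)) \<and> A = (\<Union>n. B n))"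

(* The topology is the library's product topology on functions into the discrete space
   bool. *)
definition comeagre :: "cantor set \<Rightarrow> bool" where
  "comeagre X \<longleftrightarrow> meagre (- X)"

(* Completion of the product of the fair coin measures. *)
definition cantor_measure :: "cantor measure" where
  "cantor_measure = completion (Pi\<^sub>M UNIV (\<lambda>_::nat. measure_pmf (bernoulli_pmf (1/2))))"

definition F_cif :: "cantor set set" where
  "F_cif = {X. co_interval_free X}"

definition F_comeagre :: "cantor set set" where
  "F_comeagre = {X. comeagre X}"

definition F_measure_one :: "cantor set set" where
  "F_measure_one = {X \<in> sets cantor_measure. emeasure cantor_measure X = 1}"

end

theory Submission
  imports Defs
begin

text \<open>Realisers are translated in both directions by recursion on the formula.  To get a Kleene
  realiser from an \<open>F\<close>-realiser, each computation with an oracle is replaced by a search for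
  a finite oracle (a list followed by zeros) for which it halts.  The result is
  correct: a halting computation uses only finitely much of its oracle, so the same result is
  obtained on a whole cylinder, and every co-interval-free set meets that cylinder.  In the other
  direction an ordinary program needs no oracle, so the same search gives the result of the given
  realiser.  The two translations call each other at implications, so they are implemented by one
  program that has access to its own code.\<close>

section \<open>Register programs and their compilation\<close>

text \<open>The two programs that are constructed do not depend on the family \<open>F\<close>; it
  enters only into the proof that they are correct. What makes the construction laborious is that
  realisers are codes of concrete quadruple machines and their outputs are codes again: a translated
  realiser has to print the codes of translated realisers of subformulas. So one machine must
  compute, as numbers, the codes of infinitely many variants of itself. For this reason all variants
  share one compiled body and differ only in some states placed before it, which write a parameter
  on the tape; such codes are easy to compute. The body has the shape of Kleene's normal form: a
  single unbounded loop over a number \<open>t\<close>, with a primitive recursive test and a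
  primitive recursive output function. The number \<open>t\<close> pairs a finite oracle with a
  bound on the steps, so one loop searches through both. As the compiled machine contains no query,
  it is an ordinary program and can serve as a realiser on either side.\<close>

datatype com = Inc nat | Dec nat | Seq com com (infixr ";;" 60) | While nat com

type_synonym regs = "nat \<Rightarrow> nat"

text \<open>\<open>Dec\<close> has no rule on an empty register, so its machine code has to cope
  with nonempty tracks only.\<close>

inductive big_step :: "com \<Rightarrow> regs \<Rightarrow> regs \<Rightarrow> bool" where
  big_Inc: "big_step (Inc i) s (s(i := Suc (s i)))"
| big_Dec: "s i = Suc k \<Longrightarrow> big_step (Dec i) s (s(i := k))"
| big_Seq: "big_step c s s' \<Longrightarrow> big_step d s' s'' \<Longrightarrow> big_step (c ;; d) s s''"
| big_While_end: "s i = 0 \<Longrightarrow> big_step (While i c) s s"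
| big_While_step: "s i \<noteq> 0 \<Longrightarrow> big_step c s s' \<Longrightarrow> big_step (While i c) s' s'' \<Longrightarrow>
    big_step (While i c) s s''"

primrec width :: "com \<Rightarrow> nat" where
  "width (Inc i) = Suc i"
| "width (Dec i) = Suc i"
| "width (c ;; d) = max (width c) (width d)"
| "width (While i c) = max (Suc i) (width c)"

primrec size_code :: "com \<Rightarrow> nat" where
  "size_code (Inc i) = 2"
| "size_code (Dec i) = 4"
| "size_code (c ;; d) = size_code c + size_code d"
| "size_code (While i c) = size_code c + 2"

definition table :: "nat \<Rightarrow> nat \<Rightarrow> (nat \<Rightarrow> action) \<Rightarrow> program" where
  "table R q f = map (\<lambda>a. ((q, a), f a)) [0..<2 ^ R]"

text \<open>A block is entered in state \<open>q\<close> and left in state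
  \<open>q + size_code c\<close>, with the head at home both times. \<open>Inc\<close> and
  \<open>Dec\<close> walk along track \<open>i\<close> to its first empty cell, change one bit and
  return to the blank left end. No action merely changes the state, so \<open>While\<close> jumps by
  rewriting the scanned symbol; in the home cell, bit \<open>i\<close> is set iff register
  \<open>i\<close> is nonzero.\<close>

primrec code :: "nat \<Rightarrow> com \<Rightarrow> nat \<Rightarrow> program" where
  "code R (Inc i) q =
     table R q (\<lambda>a. if bit a i then MoveR q else Write (set_bit i a) (q + 1)) @
     table R (q + 1) (\<lambda>a. if a = 0 then MoveR (q + 2) else MoveL (q + 1))"
| "code R (Dec i) q =
     table R q (\<lambda>a. if bit a i then MoveR q else MoveL (q + 1)) @
     table R (q + 1) (\<lambda>a. Write (unset_bit i a) (q + 2)) @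
     table R (q + 2) (\<lambda>a. MoveL (q + 3)) @
     table R (q + 3) (\<lambda>a. if a = 0 then MoveR (q + 4) else MoveL (q + 3))"
| "code R (c ;; d) q = code R c q @ code R d (q + size_code c)"
| "code R (While i c) q =
     table R q (\<lambda>a. Write a (if bit a i then q + 1 else q + size_code c + 2)) @
     code R c (q + 1) @
     table R (q + size_code c + 1) (\<lambda>a. Write a q)"

section \<open>Head movements on a one-sided tape, without queries\<close>

inductive move :: "program \<Rightarrow> nat \<times> (nat \<Rightarrow> nat) \<times> nat \<Rightarrow> nat \<times> (nat \<Rightarrow> nat) \<times> nat \<Rightarrow> bool"
  for M where
  move_right: "map_of M (q, S m) = Some (MoveR q') \<Longrightarrow> move M (q, S, m) (q', S, Suc m)"
| move_left: "map_of M (q, S (Suc m)) = Some (MoveL q') \<Longrightarrow> move M (q, S, Suc m) (q', S, m)"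
| move_write: "map_of M (q, S m) = Some (Write a q') \<Longrightarrow> move M (q, S, m) (q', S(m := a), m)"

lemma move_jump: "map_of M (q, S m) = Some (Write (S m) q') \<Longrightarrow> move M (q, S, m) (q', S, m)"
  using move_write[of M q S m "S m" q'] by (simp only: fun_upd_triv)

definition moves :: "program \<Rightarrow> nat \<times> (nat \<Rightarrow> nat) \<times> nat \<Rightarrow> nat \<times> (nat \<Rightarrow> nat) \<times> nat \<Rightarrow> bool"
  where "moves M = (move M)\<^sup>*\<^sup>*"

lemma moves_refl [simp]: "moves M c c"
  by (simp add: moves_def)

lemma moves_trans [trans]:
  "moves M c d \<Longrightarrow> moves M d e \<Longrightarrow> moves M c e"
  "move M c d \<Longrightarrow> moves M d e \<Longrightarrow> moves M c e"
  "moves M c d \<Longrightarrow> move M d e \<Longrightarrow> moves M c e"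
  "move M c d \<Longrightarrow> move M d e \<Longrightarrow> moves M c e"
  by (simp_all add: moves_def converse_rtranclp_into_rtranclp)

lemma moves_move: "move M c d \<Longrightarrow> moves M c d"
  by (simp add: moves_def)

definition cell :: "nat list \<Rightarrow> nat \<Rightarrow> nat" where
  "cell xs j = (if j < length xs then xs ! j else 0)"

lemma cell_simps [simp]:
  "cell (x # xs) 0 = x" "cell (x # xs) (Suc j) = cell xs j" "cell [] j = 0"
  by (auto simp: cell_def)

lemma cell_tl: "cell (tl xs) j = cell xs (Suc j)"
  by (cases xs) auto

lemma scanned_eq_cell: "scanned xs = cell xs 0"
  by (cases xs) (auto simp: scanned_def)

text \<open>Compared cell by cell, because lists that differ in trailing blanks represent the same
  tape.\<close>

definition on_tape :: "(nat \<Rightarrow> nat) \<Rightarrow> nat \<Rightarrow> nat list \<Rightarrow> nat list \<Rightarrow> bool" where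
  "on_tape S m l r \<longleftrightarrow>
     (\<forall>j. cell l j = (if j < m then S (m - 1 - j) else 0)) \<and> (\<forall>j. cell r j = S (m + j))"

lemma exec_step: "f c = Some c' \<Longrightarrow> exec f c = exec f c'"
  by (subst exec.simps) simp

lemma exec_halt: "f c = None \<Longrightarrow> exec f c = Some (ones c)"
  by (subst exec.simps) simp

lemma move_step:
  assumes "move M (q, S, m) (q', S', m')" "on_tape S m l r"
  shows "\<exists>l' r'. on_tape S' m' l' r' \<and> step M u (q, l, r) = Some (q', l', r')"
proof -
  have sc: "scanned r = S m"
    using assms(2) by (simp add: on_tape_def scanned_eq_cell)
  have r: "\<And>j. cell r j = S (m + j)" and l: "\<And>j. cell l j = (if j < m then S (m - 1 - j) else 0)"
    using assms(2) by (auto simp: on_tape_def)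
  from assms(1) show ?thesis
  proof cases
    case move_right
    have "on_tape S (Suc m) (scanned r # l) (tl r)"
      unfolding on_tape_def
    proof (intro conjI allI)
      fix j show "cell (scanned r # l) j = (if j < Suc m then S (Suc m - 1 - j) else 0)"
        by (cases j) (auto simp: sc l)
      show "cell (tl r) j = S (Suc m + j)" by (simp add: cell_tl r)
    qed
    then show ?thesis using move_right by (simp add: sc)
  next
    case move_left
    have l0: "scanned l = S m'" using l[of 0] move_left by (simp add: scanned_eq_cell)
    have "on_tape S m' (tl l) (scanned l # r)"
      unfolding on_tape_def
    proof (intro conjI allI)
      fix j show "cell (scanned l # r) j = S (m' + j)"
        by (cases j) (auto simp: l0 r move_left)
      show "cell (tl l) j = (if j < m' then S (m' - 1 - j) else 0)"
        using move_left by (auto simp: cell_tl l)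
    qed
    then show ?thesis using move_left by (simp add: sc)
  next
    case (move_write a)
    have "on_tape (S(m := a)) m l (a # tl r)"
      unfolding on_tape_def
    proof (intro conjI allI)
      fix j show "cell (a # tl r) j = (S(m := a)) (m + j)"
        by (cases j) (auto simp: cell_tl r)
      show "cell l j = (if j < m then (S(m := a)) (m - 1 - j) else 0)"
        by (auto simp: l)
    qed
    then show ?thesis using move_write by (simp add: sc)
  qed
qed

text \<open>The oracle \<open>u\<close> is arbitrary since \<open>move\<close> has no rule for
  queries.\<close>

lemma moves_exec:
  assumes "moves M (q, S, m) (q', S', m')" "on_tape S m l r"
  shows "\<exists>l' r'. on_tape S' m' l' r' \<and>
    exec (step M u) (q, l, r) = exec (step M u) (q', l', r')"
  using assms unfolding moves_def
proof (induction "(q, S, m)" arbitrary: q S m l r rule: converse_rtranclp_induct)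
  case base
  then show ?case by blast
next
  case (step z)
  obtain q1 S1 m1 where z: "z = (q1, S1, m1)" by (cases z)
  obtain l1 r1 where 1: "on_tape S1 m1 l1 r1" "step M u (q, l, r) = Some (q1, l1, r1)"
    using move_step[OF step(1)[unfolded z] step(4)] by blast
  from step(3)[OF z 1(1)] show ?case using exec_step[of "step M u", OF 1(2)] by metis
qed

lemma walk_right:
  assumes "\<And>j. m \<le> j \<Longrightarrow> j < m' \<Longrightarrow> map_of M (q, S j) = Some (MoveR q)" "m \<le> m'"
  shows "moves M (q, S, m) (q, S, m')"
  using assms(2,1)
proof (induction m' rule: dec_induct)
  case (step n)
  then have "moves M (q, S, m) (q, S, n)" by simp
  moreover have "move M (q, S, n) (q, S, Suc n)" using step by (intro move_right) simp
  ultimately show ?case by (rule moves_trans)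
qed simp

lemma walk_left:
  assumes "\<And>j. 0 < j \<Longrightarrow> j \<le> m \<Longrightarrow> map_of M (q, S j) = Some (MoveL q)"
  shows "moves M (q, S, m) (q, S, 0)"
  using assms
proof (induction m)
  case (Suc m)
  have "move M (q, S, Suc m) (q, S, m)" using Suc.prems by (intro move_left) simp
  then show ?case by (rule moves_trans(2)) (use Suc in simp)
qed simp

text \<open>Register \<open>i\<close> is kept in unary on track \<open>i\<close> of the tape: bit \<open>i\<close> of the symbol in cell
  \<open>j + 1\<close> tells whether \<open>j < s i\<close>.  Cell 0 stays blank and marks the left end; cell 1 is the
  home position.\<close>

definition symbol :: "nat \<Rightarrow> regs \<Rightarrow> nat \<Rightarrow> nat" where
  "symbol R s j = horner_sum of_bool 2 (map (\<lambda>i. j < s i) [0..<R])"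

definition tape :: "nat \<Rightarrow> regs \<Rightarrow> nat \<Rightarrow> nat" where
  "tape R s j = (case j of 0 \<Rightarrow> 0 | Suc k \<Rightarrow> symbol R s k)"

lemma tape_simps [simp]: "tape R s 0 = 0" "tape R s (Suc k) = symbol R s k"
  by (simp_all add: tape_def)

lemma bit_symbol [simp]: "bit (symbol R s j) i \<longleftrightarrow> i < R \<and> j < s i"
  by (auto simp: symbol_def bit_horner_sum_bit_iff)

lemma symbol_less: "symbol R s j < 2 ^ R"
  by (metis (no_types, lifting) symbol_def horner_sum_of_bool_2_less length_map length_upt
      minus_nat.diff_0)

lemma tape_less: "tape R s j < 2 ^ R"
  by (cases j) (auto simp: symbol_less)

lemma symbol_neq_0: "i < R \<Longrightarrow> j < s i \<Longrightarrow> symbol R s j \<noteq> 0"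
  by (metis bit_symbol bit_0_eq bot_apply bot_bool_def)

text \<open>If a unary register grows or shrinks by one, a single cell changes: cell
  \<open>Suc k\<close>, where \<open>k\<close> is the smaller of the two values.\<close>

lemma tape_upd: "tape R (s(i := v)) = (tape R s)(Suc k := a)"
  if "\<And>j. j \<noteq> k \<Longrightarrow> j < v \<longleftrightarrow> j < s i" "a = symbol R (s(i := v)) k"
proof
  fix j
  have "symbol R (s(i := v)) n = symbol R s n" if "n \<noteq> k" for n
    using that \<open>\<And>j. j \<noteq> k \<Longrightarrow> j < v \<longleftrightarrow> j < s i\<close> by (intro bit_eqI) auto
  then show "tape R (s(i := v)) j = ((tape R s)(Suc k := a)) j"
    using that(2) by (cases j) auto
qed

text \<open>In terms of \<open>map_of\<close>, since an entry of the list may be shadowed by an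
  earlier one with the same key.\<close>

definition installs :: "program \<Rightarrow> program \<Rightarrow> bool" where
  "installs M P \<longleftrightarrow> (\<forall>(k, a) \<in> set P. map_of M k = Some a)"

lemma installs_append [simp]: "installs M (P @ Q) \<longleftrightarrow> installs M P \<and> installs M Q"
  by (auto simp: installs_def)

lemma installs_subset: "installs M Q \<Longrightarrow> set P \<subseteq> set Q \<Longrightarrow> installs M P"
  by (auto simp: installs_def)

lemma installs_table: "installs M (table R q f) \<Longrightarrow> a < 2 ^ R \<Longrightarrow> map_of M (q, a) = Some (f a)"
  by (auto simp: installs_def table_def)

lemma installs_table_tape:
  "installs M (table R q f) \<Longrightarrow> map_of M (q, tape R s j) = Some (f (tape R s j))"
  by (rule installs_table[OF _ tape_less])

section \<open>Correctness of the compiled code\<close>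

lemma code_correct:
  assumes "big_step c s s'" "width c \<le> R" "installs M (code R c q)"
  shows "moves M (q, tape R s, 1) (q + size_code c, tape R s', 1)"
  using assms
proof (induction arbitrary: q rule: big_step.induct)
  case (big_Inc i s)
  let ?T = "tape R s" and ?s = "s(i := Suc (s i))"
  have i: "i < R" using big_Inc by simp
  have t1: "installs M (table R q (\<lambda>a. if bit a i then MoveR q else Write (set_bit i a) (q + 1)))"
    and t2: "installs M (table R (q + 1) (\<lambda>a. if a = 0 then MoveR (q + 2) else MoveL (q + 1)))"
    using big_Inc by auto
  have eq: "?T(Suc (s i) := set_bit i (symbol R s (s i))) = tape R ?s"
    by (rule tape_upd[symmetric], force, rule bit_eqI) (auto simp: bit_set_bit_iff i)
  have "moves M (q, ?T, 1) (q, ?T, Suc (s i))"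
    by (rule walk_right)
      (auto simp: i tape_def Suc_le_eq split: nat.split intro!: trans[OF installs_table[OF t1
          symbol_less]])
  also have "move M (q, ?T, Suc (s i)) (q + 1, tape R ?s, Suc (s i))"
    unfolding eq[symmetric] using installs_table_tape[OF t1, of s "Suc (s i)"]
        by (intro move_write) simp
  also have "moves M (q + 1, tape R ?s, Suc (s i)) (q + 1, tape R ?s, 0)"
  proof (rule walk_left)
    fix j assume "0 < j" "j \<le> Suc (s i)"
    then obtain k where j: "j = Suc k" "k < ?s i" by (cases j) auto
    show "map_of M (q + 1, tape R ?s j) = Some (MoveL (q + 1))"
      using installs_table_tape[OF t2, of ?s j] symbol_neq_0[OF i, of k "?s"] j by simp
  qed
  also have "move M (q + 1, tape R ?s, 0) (q + 2, tape R ?s, Suc 0)"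
    using installs_table_tape[OF t2, of ?s 0] by (intro move_right) simp
  finally show ?case by (simp add: fun_upd_def)
next
  case (big_Dec s i k)
  let ?T = "tape R s" and ?s = "s(i := k)"
  have i: "i < R" using big_Dec by simp
  have t1: "installs M (table R q (\<lambda>a. if bit a i then MoveR q else MoveL (q + 1)))"
    and t2: "installs M (table R (q + 1) (\<lambda>a. Write (unset_bit i a) (q + 2)))"
    and t3: "installs M (table R (q + 2) (\<lambda>a. MoveL (q + 3)))"
    and t4: "installs M (table R (q + 3) (\<lambda>a. if a = 0 then MoveR (q + 4) else MoveL (q + 3)))"
    using big_Dec by auto
  have eq: "?T(Suc k := unset_bit i (symbol R s k)) = tape R ?s"
    by (rule tape_upd[symmetric], force simp: big_Dec less_Suc_eq, rule bit_eqI)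
      (auto simp: bit_unset_bit_iff i big_Dec less_Suc_eq)
  have "moves M (q, ?T, 1) (q, ?T, Suc (s i))"
    by (rule walk_right)
      (auto simp: i tape_def Suc_le_eq split: nat.split intro!: trans[OF installs_table[OF t1
          symbol_less]])
  also have "move M (q, ?T, Suc (s i)) (q + 1, ?T, Suc k)"
    using installs_table_tape[OF t1, of s "Suc (s i)"] by
        (simp only: big_Dec) (intro move_left, simp add: big_Dec)
  also have "move M (q + 1, ?T, Suc k) (q + 2, tape R ?s, Suc k)"
    unfolding eq[symmetric] using installs_table_tape[OF t2, of s "Suc k"]
        by (intro move_write) simp
  \<comment> \<open>Cell \<open>Suc k\<close> may have become blank, so the walk back starts one
    cell further left; otherwise it could take this cell for the left end.\<close>
  also have "move M (q + 2, tape R ?s, Suc k) (q + 3, tape R ?s, k)"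
    using installs_table_tape[OF t3, of ?s "Suc k"] by (intro move_left) simp
  also have "moves M (q + 3, tape R ?s, k) (q + 3, tape R ?s, 0)"
  proof (rule walk_left)
    fix j assume "0 < j" "j \<le> k"
    then obtain n where j: "j = Suc n" "n < ?s i" by (cases j) auto
    show "map_of M (q + 3, tape R ?s j) = Some (MoveL (q + 3))"
      using installs_table_tape[OF t4, of ?s j] symbol_neq_0[OF i, of n "?s"] j by simp
  qed
  also have "move M (q + 3, tape R ?s, 0) (q + 4, tape R ?s, Suc 0)"
    using installs_table_tape[OF t4, of ?s 0] by (intro move_right) simp
  finally show ?case by (simp add: fun_upd_def)
next
  case (big_Seq c s s' d s'')
  then have "moves M (q, tape R s, 1) (q + size_code c, tape R s', 1)"
    "moves M (q + size_code c, tape R s', 1) (q + size_code c + size_code d, tape R s'', 1)"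
    by auto
  from moves_trans(1)[OF this] show ?case by (simp add: add.assoc)
next
  case (big_While_end s i c)
  have t1: "installs M (table R q (\<lambda>a. Write a (if bit a i then q + 1 else q + size_code c + 2)))"
    using big_While_end by simp
  have "move M (q, tape R s, 1) (q + size_code (While i c), tape R s, 1)"
    by (rule move_jump) (use installs_table_tape[OF t1, of s 1] big_While_end in simp)
  then show ?case by (rule moves_move)
next
  case (big_While_step s i c s' s'')
  have t1: "installs M (table R q (\<lambda>a. Write a (if bit a i then q + 1 else q + size_code c + 2)))"
    and t2: "installs M (table R (q + size_code c + 1) (\<lambda>a. Write a q))"
    using big_While_step by simp_all
  have "move M (q, tape R s, 1) (q + 1, tape R s, 1)"
    by (rule move_jump) (use installs_table_tape[OF t1, of s 1] big_While_step in simp)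
  also have "moves M (q + 1, tape R s, 1) (q + 1 + size_code c, tape R s', 1)"
    using big_While_step.IH(1)[of "q + 1"] big_While_step.prems by simp
  also have "move M (q + 1 + size_code c, tape R s', 1) (q, tape R s', 1)"
    by (rule move_jump) (use installs_table_tape[OF t2, of s' 1] in simp)
  also have "moves M (q, tape R s', 1) (q + size_code (While i c), tape R s'', 1)"
    using big_While_step.IH(2)[of q] big_While_step.prems by simp
  finally show ?case .
qed

lemma set_table: "set (table R q f) = (\<lambda>a. ((q, a), f a)) ` {..<2 ^ R}"
  by (auto simp: table_def)

lemma states_code: "((q', a), act) \<in> set (code R c q) \<Longrightarrow> q \<le> q' \<and> q' < q + size_code c"
  by (induction c arbitrary: q) (fastforce simp: set_table)+

lemma distinct_table: "distinct (map fst (table R q f))"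
  by (auto simp: table_def distinct_map inj_on_def comp_def)

lemma distinct_code: "distinct (map fst (code R c q))"
proof (induction c arbitrary: q)
  case (Seq c d)
  have "fst ` set (code R c q) \<inter> fst ` set (code R d (q + size_code c)) = {}"
    by (force dest: states_code)
  then show ?case using Seq by simp
qed (auto simp: distinct_table set_table dest: states_code)

lemma ordinary_code: "(k, Query q1 q2) \<notin> set (code R c q)"
  by (induction c arbitrary: q) (auto simp: set_table split: if_splits)

section \<open>Codes of programs, and parameters built into the states\<close>

fun enc_action :: "action \<Rightarrow> nat" where
  "enc_action (MoveL q) = prod_encode (0, q)"
| "enc_action (MoveR q) = prod_encode (1, q)"
| "enc_action (Write a q) = prod_encode (2, prod_encode (a, q))"
| "enc_action (Query q q') = prod_encode (3, prod_encode (q, q'))"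

fun enc_entry :: "(nat \<times> nat) \<times> action \<Rightarrow> nat" where
  "enc_entry (k, act) = prod_encode (prod_encode k, enc_action act)"

definition enc_program :: "program \<Rightarrow> nat" where
  "enc_program M = list_encode (map enc_entry M)"

lemma action_of_enc_action [simp]: "action_of (prod_decode (enc_action act)) = act"
  by (cases act) auto

lemma program_of_enc_program [simp]: "program_of (enc_program M) = M"
  by (auto simp: program_of_def enc_program_def intro!: map_idI)

text \<open>States \<open>B + y\<close>, \dots, \<open>B + 1\<close> write \<open>y\<close> into register 1 (track 1 of the tape) while
  walking right from the home cell; state \<open>B\<close> is reached on the cell after the last one.\<close>

primrec loader :: "nat \<Rightarrow> program \<Rightarrow> nat \<Rightarrow> program" where
  "loader B T 0 = T"
| "loader B T (Suc j) =
     ((B + Suc j, 0), Write 2 (B + Suc j)) # ((B + Suc j, 1), Write 3 (B + Suc j)) #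
     ((B + Suc j, 2), MoveR (B + j)) # ((B + Suc j, 3), MoveR (B + j)) # loader B T j"

text \<open>The machine starts in state 0 on a 1; rewriting this 1 jumps to state
  \<open>B + y\<close>. The parameter is thus recorded in the number of loader states.\<close>

definition load_program :: "nat \<Rightarrow> program \<Rightarrow> nat \<Rightarrow> program" where
  "load_program B T y = ((0, 1), Write 1 (B + y)) # loader B T y"

text \<open>States 1 to \<open>size_code c\<close> carry the compiled code. Its exit
  \<open>size_code c + 1\<close> has no entries, so the machine halts there. State
  \<open>size_code c + 2\<close> walks home after loading, and loading ends in the next one, the
  base.\<close>

definition load_base :: "com \<Rightarrow> nat" where
  "load_base c = size_code c + 3"

definition load_tail :: "nat \<Rightarrow> com \<Rightarrow> program" where
  "load_tail R c = code R c 1 @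
     (let w = size_code c + 2 in
       [((w + 1, 0), MoveL w), ((w + 1, 1), MoveL w),
        ((w, 0), MoveR 1), ((w, 1), MoveL w), ((w, 2), MoveL w), ((w, 3), MoveL w)])"

lemma states_load_tail:
  "((q, a), act) \<in> set (load_tail R c) \<Longrightarrow> 0 < q \<and> q \<le> load_base c \<and> q \<noteq> size_code c + 1"
  by (auto simp: load_tail_def load_base_def Let_def dest!: states_code)

lemma distinct_load_tail: "distinct (map fst (load_tail R c))"
  by (auto simp: load_tail_def Let_def distinct_code dest!: states_code)

lemma states_loader:
  "((q, a), act) \<in> set (loader B T y) \<Longrightarrow> ((q, a), act) \<in> set T \<or> B < q \<and> q \<le> B + y"
  by (induction y) auto

lemma distinct_loader:
  assumes "distinct (map fst T)" "\<And>q a act. ((q, a), act) \<in> set T \<Longrightarrow> q \<le> B"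
  shows "distinct (map fst (loader B T y))"
proof (induction y)
  case (Suc y)
  have "((B + Suc y, a), act) \<notin> set (loader B T y)" for a act
    using states_loader[of "B + Suc y" a act B T y] assms(2)[of "B + Suc y" a act] by auto
  then show ?case using Suc by auto
qed (simp add: assms)

lemma set_tail_loader: "set T \<subseteq> set (loader B T y)"
  by (induction y) auto

lemma set_loader:
  "j < y \<Longrightarrow> {((B + Suc j, 0), Write 2 (B + Suc j)), ((B + Suc j, 1), Write 3 (B + Suc j)),
     ((B + Suc j, 2), MoveR (B + j)), ((B + Suc j, 3), MoveR (B + j))} \<subseteq> set (loader B T y)"
  by (induction y) (auto simp: less_Suc_eq)

lemma distinct_load_program:
  "distinct (map fst (load_program (load_base c) (load_tail R c) y))"
proof -
  have "((0, a), act) \<notin> set (loader (load_base c) (load_tail R c) y)" for a act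
    by (auto dest!: states_loader states_load_tail)
  then show ?thesis
    by (auto simp: load_program_def intro!: distinct_loader distinct_load_tail dest!:
        states_load_tail)
qed

lemma bit_Suc_0 [simp]: "bit (Suc 0) i \<longleftrightarrow> i = 0"
  using bit_1_iff[where 'a = nat, of i] by simp

lemma bit_lt_4: "bit (2::nat) i \<longleftrightarrow> i = 1" "bit (3::nat) i \<longleftrightarrow> i = 0 \<or> i = 1"
proof -
  show "bit (3::nat) i \<longleftrightarrow> i = 0 \<or> i = 1"
    by (cases i) (auto simp: bit_0 bit_Suc)
qed (auto simp: bit_2_iff)

text \<open>During loading only tracks 0 and 1 are occupied, which is why the loader has entries for
  the symbols 0 to 3.\<close>

lemma symbol_two:
  fixes s :: regs
  assumes "2 \<le> R" "\<And>i. 2 \<le> i \<Longrightarrow> s i = 0"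
  shows "symbol R s j = (if j < s 0 then if j < s 1 then 3 else 1 else if j < s 1 then 2 else 0)"
proof (rule bit_eqI)
  fix i :: nat
  have "i = 0 \<or> i = 1 \<or> 2 \<le> i" by linarith
  then show "bit (symbol R s j) i \<longleftrightarrow>
      bit (if j < s 0 then if j < s 1 then 3 else 1 else if j < s 1 then 2 else (0::nat)) i"
    using assms by (auto simp: bit_lt_4)
qed

lemma count_list_cells:
  assumes "\<And>j. cell xs j = (if j < n then 1 else 0)"
  shows "count_list xs 1 = n"
  using assms
proof (induction xs arbitrary: n)
  case Nil
  then have "\<not> 0 < n" by (metis cell_simps(3) zero_neq_one)
  then show ?case by simp
next
  case (Cons x xs)
  from Cons.prems[of 0] have x: "x = (if 0 < n then 1 else 0)" by simp
  have "cell xs j = (if j < n - 1 then 1 else 0)" for j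
    using Cons.prems[of "Suc j"] by auto
  from Cons.IH[OF this] x show ?case by auto
qed

text \<open>The input and output conventions fit the tape coding: \<open>n + 1\<close> ones from the
  home cell on are register 0 with value \<open>Suc n\<close>, and once all other registers are
  zero, the ones on the tape count the value of register 0.\<close>

lemma run_load_program:
  assumes c: "big_step c ((\<lambda>_. 0)(0 := Suc n, 1 := y)) ((\<lambda>_. 0)(0 := v))"
    and R: "width c \<le> R" "2 \<le> R"
  shows "run (enc_program (load_program (load_base c) (load_tail R c) y)) u n = Some v"
proof -
  define B where "B = load_base c"
  define w where "w = size_code c + 2"
  define M where "M = load_program B (load_tail R c) y"
  define s where "s i = ((\<lambda>_. 0)(0 := Suc n, 1 := i) :: regs)" for i
  have B: "B = w + 1" by (simp add: B_def load_base_def w_def)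
  have M: "map_of M k = Some a" if "(k, a) \<in> set M" for k a
    using distinct_load_program that by (simp add: M_def B_def)
  have self: "installs M M"
    using M by (auto simp: installs_def)
  have tail: "installs M (load_tail R c)"
    using set_tail_loader[of "load_tail R c" B y]
    by (intro installs_subset[OF self]) (auto simp: M_def load_program_def)
  then have inst: "installs M (code R c 1)"
    "installs M [((B, 0), MoveL w), ((B, 1), MoveL w),
        ((w, 0), MoveR 1), ((w, 1), MoveL w), ((w, 2), MoveL w), ((w, 3), MoveL w)]"
    by (auto simp: load_tail_def Let_def B w_def)
  have sym: "symbol R (s i) j =
      (if j < Suc n then if j < i then 3 else 1 else if j < i then 2 else 0)" for i j
    using symbol_two[OF R(2), of "s i" j] by (simp add: s_def)
  have "on_tape (tape R (s 0)) 1 [] (replicate (Suc n) 1)"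
    unfolding on_tape_def
  proof (intro conjI allI)
    fix j
    show "cell [] j = (if j < 1 then tape R (s 0) (1 - 1 - j) else 0)" by simp
    show "cell (replicate (Suc n) 1) j = tape R (s 0) (1 + j)"
      using sym[of 0 j] by (simp add: cell_def del: replicate_Suc)
  qed
  moreover have "moves M (0, tape R (s 0), 1) (size_code c + 1, tape R ((\<lambda>_. 0)(0 := v)), 1)"
  proof -
    have "move M (0, tape R (s 0), 1) (B + y, (tape R (s 0))(1 := 1), 1)"
      by (rule move_write, rule M) (simp add: M_def load_program_def sym)
    also have "(tape R (s 0))(1 := 1) = tape R (s 0)" by (simp add: fun_eq_iff sym)
    finally have 1: "moves M (0, tape R (s 0), 1) (B + y, tape R (s 0), 1)" by
        (simp add: moves_move)
    have 2: "moves M (B + y, tape R (s 0), 1) (B + (y - i), tape R (s i), Suc i)" if "i \<le> y" for i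
      using that
    proof (induction i)
      case (Suc i)
      obtain j where j: "y - i = Suc j" "y - Suc i = j" "j < y" using Suc.prems
        by (metis Suc_diff_Suc Suc_le_eq diff_Suc_less less_le_trans zero_less_Suc)
      have ent: "installs M [((B + Suc j, 0), Write 2 (B + Suc j)), ((B + Suc j, 1), Write 3 (B +
          Suc j)),
         ((B + Suc j, 2), MoveR (B + j)), ((B + Suc j, 3), MoveR (B + j))]"
        using set_loader[OF j(3), of B "load_tail R c"]
        by (intro installs_subset[OF self]) (auto simp: M_def load_program_def)
      have eq: "tape R (s (Suc i)) = (tape R (s i))(Suc i := symbol R (s (Suc i)) i)"
        using tape_upd[of i "Suc i" "s i" 1 "symbol R (s (Suc i)) i" R] by
            (simp add: s_def less_Suc_eq)
      have "move M (B + Suc j, tape R (s i), Suc i)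
          (B + Suc j, (tape R (s i))(Suc i := symbol R (s (Suc i)) i), Suc i)"
        by (rule move_write) (use ent in \<open>simp add: sym installs_def\<close>)
      moreover have "move M (B + Suc j, tape R (s (Suc i)), Suc i) (B + j, tape R (s (Suc i)), Suc
          (Suc i))"
        by (rule move_right) (use ent in \<open>simp add: sym installs_def\<close>)
      moreover have "moves M (B + y, tape R (s 0), 1) (B + Suc j, tape R (s i), Suc i)"
        using Suc j by simp
      ultimately show ?case unfolding j eq[symmetric]
        by (blast intro: moves_trans)
    qed simp
    \<comment> \<open>State \<open>B\<close> makes one step left before the walk home, because cell
      \<open>Suc y\<close> is blank if the parameter is longer than the input and would be taken for
      the left end.\<close>
    have 3: "move M (B, tape R (s y), Suc y) (w, tape R (s y), y)"
      by (rule move_left) (use inst(2) in \<open>auto simp: sym installs_def\<close>)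
    have 4: "moves M (w, tape R (s y), y) (w, tape R (s y), 0)"
    proof (rule walk_left)
      fix j assume "0 < j" "j \<le> y"
      then obtain k where "j = Suc k" "k < y" by (cases j) auto
      then show "map_of M (w, tape R (s y) j) = Some (MoveL w)"
        using inst(2) by (auto simp: sym installs_def)
    qed
    have 5: "move M (w, tape R (s y), 0) (1, tape R (s y), Suc 0)"
      by (rule move_right) (use inst(2) in \<open>auto simp: installs_def\<close>)
    have 6: "moves M (1, tape R (s y), 1) (1 + size_code c, tape R ((\<lambda>_. 0)(0 := v)), 1)"
      using code_correct[OF c R(1) inst(1)] by (simp add: s_def)
    note 1
    also have "moves M (B + y, tape R (s 0), 1) (B, tape R (s y), Suc y)" using 2[of y] by simp
    also note 3 also note 4 also note 5
    also have "moves M (1, tape R (s y), Suc 0) (size_code c + 1, tape R ((\<lambda>_. 0)(0 := v)), 1)"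
      using 6 by simp
    finally show ?thesis .
  qed
  ultimately obtain l r where lr: "on_tape (tape R ((\<lambda>_. 0)(0 := v))) 1 l r"
    "exec (step M u) (0, [], replicate (Suc n) 1) = exec (step M u) (size_code c + 1, l, r)"
    using moves_exec by blast
  have "map_of M (size_code c + 1, a) = None" for a
  proof -
    have "((size_code c + 1, a), act) \<notin> set M" for act
      by (auto simp: M_def load_program_def B_def load_base_def dest!: states_loader
          states_load_tail)
    then show ?thesis by (meson map_of_SomeD not_Some_eq)
  qed
  then have "exec (step M u) (size_code c + 1, l, r) = Some (ones (size_code c + 1, l, r))"
    by (intro exec_halt) simp
  moreover have "count_list l 1 = 0"
    by (rule count_list_cells) (use lr in \<open>auto simp: on_tape_def\<close>)
  moreover have "count_list r 1 = v"
    by (rule count_list_cells)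
      (use lr R symbol_two[of R "(\<lambda>_. 0)(0 := v)"] in \<open>auto simp: on_tape_def\<close>)
  ultimately show ?thesis using lr by (simp add: run_def M_def B_def)
qed

lemma ordinary_load_program:
  "ordinary (enc_program (load_program B (load_tail R c) y))"
proof -
  have "(k, Query q q') \<notin> set (loader B (load_tail R c) y)" for k q q'
    by (induction y) (auto simp: load_tail_def Let_def ordinary_code)
  then show ?thesis by (fastforce simp: ordinary_def load_program_def)
qed

section \<open>Primitive recursive functions\<close>

definition pfst :: "nat \<Rightarrow> nat" where "pfst x = fst (prod_decode x)"
definition psnd :: "nat \<Rightarrow> nat" where "psnd x = snd (prod_decode x)"

lemma pfst_psnd [simp]:
  "pfst (prod_encode (a, b)) = a" "psnd (prod_encode (a, b)) = b"
  by (simp_all add: pfst_def psnd_def)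

lemma prod_encode_pfst_psnd [simp]: "prod_encode (pfst x, psnd x) = x"
  by (simp add: pfst_def psnd_def)

lemma prod_encode_0 [simp]: "prod_encode (0, 0) = 0"
  by (simp add: prod_encode_def)

lemma pfst_psnd_0 [simp]: "pfst 0 = 0" "psnd 0 = 0"
  using pfst_psnd[of 0 0] by simp_all

text \<open>In this unary form, pairing supplies further arguments and iteration replaces the
  recursion scheme, so that a compiler needs only one kind of loop.\<close>

inductive prim_rec :: "(nat \<Rightarrow> nat) \<Rightarrow> bool" where
  prim_rec_id: "prim_rec (\<lambda>x. x)"
| prim_rec_zero: "prim_rec (\<lambda>x. 0)"
| prim_rec_succ: "prim_rec Suc"
| prim_rec_fst: "prim_rec pfst"
| prim_rec_snd: "prim_rec psnd"
| prim_rec_comp: "prim_rec f \<Longrightarrow> prim_rec g \<Longrightarrow> prim_rec (\<lambda>x. f (g x))"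
| prim_rec_pair: "prim_rec f \<Longrightarrow> prim_rec g \<Longrightarrow> prim_rec (\<lambda>x. prod_encode (f x, g x))"
| prim_rec_pow: "prim_rec h \<Longrightarrow> prim_rec (\<lambda>x. (h ^^ pfst x) (psnd x))"

text \<open>The registers act as a stack with top \<open>b\<close>: everything above is scratch
  space, zero before and after, and everything below is preserved. Hence implementations nest by
  shifting \<open>b\<close>.\<close>

definition implements :: "com \<Rightarrow> nat \<Rightarrow> (nat \<Rightarrow> nat) \<Rightarrow> bool" where
  "implements c b f \<longleftrightarrow> (\<forall>s. (\<forall>j>b. s j = 0) \<longrightarrow> big_step c s (s(b := f (s b))))"

lemma big_conv: "big_step c s t \<Longrightarrow> t = t' \<Longrightarrow> big_step c s t'"
  by simp

section \<open>Register programs for moving, pairing and unpairing numbers\<close>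

definition clear :: "nat \<Rightarrow> com" where "clear x = While x (Dec x)"
definition move_to :: "nat \<Rightarrow> nat \<Rightarrow> com" where "move_to x y = While x (Dec x ;; Inc y)"
definition move_both :: "nat \<Rightarrow> nat \<Rightarrow> nat \<Rightarrow> com" where
  "move_both x y z = While x (Dec x ;; Inc y ;; Inc z)"

lemma big_clear: "big_step (clear x) s (s(x := 0))"
  unfolding clear_def
proof (induction "s x" arbitrary: s)
  case 0
  then show ?case using big_While_end[of s x] by (simp add: fun_upd_idem)
next
  case (Suc k)
  have "big_step (While x (Dec x)) (s(x := k)) (s(x := 0))"
    using Suc(1)[of "s(x := k)"] by simp
  then show ?case using Suc(2)[symmetric] by (auto intro: big_While_step big_Dec)
qed

lemma big_move_to: "x \<noteq> y \<Longrightarrow> big_step (move_to x y) s (s(x := 0, y := s y + s x))"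
  unfolding move_to_def
proof (induction "s x" arbitrary: s)
  case 0
  then show ?case using big_While_end[of s x] by (simp add: fun_upd_idem)
next
  case (Suc k)
  let ?s = "s(x := k, y := Suc (s y))"
  have "big_step (While x (Dec x ;; Inc y)) ?s (s(x := 0, y := s y + s x))"
    using Suc(2) by (intro big_conv[OF Suc(1)[of ?s]]) (auto simp: fun_eq_iff Suc.prems)
  moreover have "big_step (Dec x ;; Inc y) s ?s"
    using Suc(2)[symmetric] Suc.prems
    by (intro big_Seq[OF big_Dec] big_conv[OF big_Inc]) (auto simp: fun_eq_iff)
  ultimately show ?case using Suc(2)[symmetric] by (auto intro: big_While_step)
qed

lemma big_move_both:
  "x \<noteq> y \<Longrightarrow> x \<noteq> z \<Longrightarrow> y \<noteq> z \<Longrightarrow>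
    big_step (move_both x y z) s (s(x := 0, y := s y + s x, z := s z + s x))"
  unfolding move_both_def
proof (induction "s x" arbitrary: s)
  case 0
  then show ?case using big_While_end[of s x] by (simp add: fun_upd_idem)
next
  case (Suc k)
  let ?s = "s(x := k, y := Suc (s y), z := Suc (s z))"
  have "big_step (While x (Dec x ;; Inc y ;; Inc z)) ?s (s(x := 0, y := s y + s x, z := s z + s x))"
    using Suc(2) by (intro big_conv[OF Suc(1)[of ?s]]) (auto simp: fun_eq_iff Suc.prems)
  moreover have "big_step (Dec x ;; Inc y ;; Inc z) s ?s"
    using Suc(2)[symmetric] Suc.prems
    by (intro big_Seq[OF big_Dec] big_Seq[OF big_Inc] big_conv[OF big_Inc]) (auto simp: fun_eq_iff)
  ultimately show ?case using Suc(2)[symmetric] by (auto intro: big_While_step)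
qed

definition add_triangle :: "nat \<Rightarrow> com" where
  "add_triangle b = While b (Dec b ;; Inc (b + 2) ;; move_both b (b + 1) (b + 2) ;; move_to (b +
      1) b)"

lemma big_add_triangle:
  assumes "s (b + 1) = 0"
  shows "big_step (add_triangle b) s (s(b := 0, b + 2 := s (b + 2) + triangle (s b)))"
  using assms
proof (induction "s b" arbitrary: s)
  case 0
  then show ?case using big_While_end[of s b] by (simp add: add_triangle_def fun_upd_idem)
next
  case (Suc k)
  let ?s = "s(b := k, b + 2 := s (b + 2) + Suc k)"
  have "big_step (Dec b ;; Inc (b + 2) ;; move_both b (b + 1) (b + 2) ;; move_to (b + 1) b) s ?s"
    using Suc(2)[symmetric] Suc.prems
    by (intro big_Seq[OF big_Dec] big_Seq[OF big_Inc] big_Seq[OF big_move_both]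
          big_conv[OF big_move_to]) (auto simp: fun_eq_iff)
  moreover have "big_step (add_triangle b) ?s (s(b := 0, b + 2 := s (b + 2) + triangle (s b)))"
    using Suc(2)[symmetric] Suc.prems by (intro big_conv[OF Suc(1)[of ?s]]) (auto simp: fun_eq_iff)
  ultimately show ?case using Suc(2)[symmetric] unfolding add_triangle_def by
      (auto intro: big_While_step)
qed

text \<open>Follows \<open>prod_encode (m, n) = triangle (m + n) + m\<close>, with \<open>m\<close>
  in register \<open>b + 1\<close> and \<open>n\<close> in register \<open>b\<close>.\<close>

definition encode :: "nat \<Rightarrow> com" where
  "encode b = move_both (b + 1) b (b + 2) ;; add_triangle b ;; move_to (b + 2) b"

lemma big_encode:
  assumes "s (b + 2) = 0"
  shows "big_step (encode b) s (s(b := prod_encode (s (b + 1), s b), b + 1 := 0))"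
  unfolding encode_def using assms
  by (intro big_Seq[OF big_move_both] big_Seq[OF big_add_triangle] big_conv[OF big_move_to])
    (auto simp: fun_eq_iff prod_encode_def add.commute)

text \<open>Advances \<open>(a, c)\<close> to the next pair in the enumeration \<open>prod_encode\<close>; register
  \<open>e\<close> records whether \<open>c\<close> was 0.\<close>

definition next_pair :: "nat \<Rightarrow> nat \<Rightarrow> nat \<Rightarrow> nat \<Rightarrow> com" where
  "next_pair a c d e =
     Inc e ;;
     While c (Dec c ;; Inc a ;; Dec e ;; move_to c d) ;;
     move_to d c ;;
     While e (Dec e ;; move_to a c ;; Inc c)"

text \<open>The enumeration runs along antidiagonals: \<open>(a, Suc k)\<close> is followed by
  \<open>(Suc a, k)\<close>, and \<open>(a, 0)\<close> by \<open>(0, Suc a)\<close>.\<close>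

lemma big_next_pair:
  assumes "distinct [a, c, d, e]" "s d = 0" "s e = 0" "prod_encode (m, n) =
      Suc (prod_encode (s a, s c))"
  shows "big_step (next_pair a c d e) s (s(a := m, c := n))"
proof (cases "s c")
  case 0
  have "prod_encode (0, Suc (s a)) = Suc (prod_encode (s a, 0))"
    by (simp add: prod_encode_def)
  then have "(m, n) = (0, Suc (s a))"
    using assms(4) by (metis 0 prod_encode_eq)
  then have mn: "m = 0" "n = Suc (s a)" by auto
  let ?s = "s(e := 1)"
  have "big_step (Dec e ;; move_to a c ;; Inc c) ?s (s(a := m, c := n))"
    using assms 0 mn by (intro big_Seq[OF big_Dec] big_Seq[OF big_move_to] big_conv[OF big_Inc])
      (auto simp: fun_eq_iff)
  then have "big_step (While e (Dec e ;; move_to a c ;; Inc c)) ?s (s(a := m, c := n))"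
    by (rule big_While_step[rotated]) (use assms in \<open>auto intro!: big_While_end\<close>)
  moreover have "big_step (move_to d c) ?s ?s"
    using assms 0 by (intro big_conv[OF big_move_to]) (auto simp: fun_eq_iff)
  moreover have "big_step (While c (Dec c ;; Inc a ;; Dec e ;; move_to c d)) ?s ?s"
    using assms 0 by (intro big_While_end) auto
  moreover have "big_step (Inc e) s ?s"
    using assms by (intro big_conv[OF big_Inc]) auto
  ultimately show ?thesis unfolding next_pair_def by (blast intro: big_Seq)
next
  case (Suc k)
  have "prod_encode (Suc (s a), k) = Suc (prod_encode (s a, Suc k))"
    by (simp add: prod_encode_def)
  then have "(m, n) = (Suc (s a), k)"
    using assms(4) by (metis Suc prod_encode_eq)
  then have mn: "m = Suc (s a)" "n = k" by auto
  let ?s = "s(e := 1)" and ?t = "s(a := m, c := 0, d := k)"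
  have "big_step (Dec c ;; Inc a ;; Dec e ;; move_to c d) ?s ?t"
    using assms Suc mn
    by (intro big_Seq[OF big_Dec] big_Seq[OF big_Inc] big_conv[OF big_move_to])
        (auto simp: fun_eq_iff)
  then have "big_step (While c (Dec c ;; Inc a ;; Dec e ;; move_to c d)) ?s ?t"
    by (rule big_While_step[rotated]) (use assms Suc in \<open>auto intro!: big_While_end\<close>)
  moreover have "big_step (move_to d c) ?t (s(a := m, c := n))"
    using assms Suc mn by (intro big_conv[OF big_move_to]) (auto simp: fun_eq_iff)
  moreover have "big_step (While e (Dec e ;; move_to a c ;; Inc c)) (s(a := m, c := n)) (s(a :=
      m, c := n))"
    using assms Suc by (intro big_While_end) auto
  moreover have "big_step (Inc e) s ?s"
    using assms by (intro big_conv[OF big_Inc]) auto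
  ultimately show ?thesis unfolding next_pair_def by (blast intro: big_Seq)
qed

text \<open>Unpairing by counting: from \<open>(0, 0)\<close>, whose code is 0, the pair is advanced
  once for each unit in register \<open>b\<close>.\<close>

definition decode :: "nat \<Rightarrow> com" where
  "decode b = While b (Dec b ;; next_pair (b + 1) (b + 2) (b + 3) (b + 4))"

lemma big_decode_from:
  assumes "s (b + 3) = 0" "s (b + 4) = 0" "x = s b + prod_encode (s (b + 1), s (b + 2))"
  shows "big_step (decode b) s (s(b := 0, b + 1 := pfst x, b + 2 := psnd x))"
  using assms
proof (induction "s b" arbitrary: s)
  case 0
  then have "s = s(b := 0, b + 1 := pfst x, b + 2 := psnd x)" by (auto simp: fun_eq_iff)
  then show ?case unfolding decode_def by (rule big_conv[OF big_While_end[of s b, OF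
      0(1)[symmetric]]])
next
  case (Suc k)
  define p where "p = Suc (prod_encode (s (b + 1), s (b + 2)))"
  let ?s = "s(b := k, b + 1 := pfst p, b + 2 := psnd p)"
  have "big_step (Dec b ;; next_pair (b + 1) (b + 2) (b + 3) (b + 4)) s ?s"
    using Suc(2)[symmetric] Suc.prems
    by (intro big_Seq[OF big_Dec] big_conv[OF big_next_pair]) (auto simp: p_def)
  moreover have "big_step (decode b) ?s (s(b := 0, b + 1 := pfst x, b + 2 := psnd x))"
    using Suc(2)[symmetric] Suc.prems
    by (intro big_conv[OF Suc(1)[of ?s]]) (auto simp: fun_eq_iff p_def)
  ultimately show ?case using Suc(2)[symmetric] unfolding decode_def by (auto intro: big_While_step)
qed

lemma big_decode:
  assumes "\<And>j. j > b \<Longrightarrow> s j = 0"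
  shows "big_step (decode b) s (s(b := 0, b + 1 := pfst (s b), b + 2 := psnd (s b)))"
  using big_decode_from[of s b "s b"] assms by simp

lemma implementsI:
  "(\<And>s. (\<And>j. j > b \<Longrightarrow> s j = 0) \<Longrightarrow> big_step c s (s(b := f (s b)))) \<Longrightarrow> implements c b f"
  by (auto simp: implements_def)

lemma big_implements:
  "implements c b f \<Longrightarrow> (\<And>j. j > b \<Longrightarrow> s j = 0) \<Longrightarrow> big_step c s (s(b := f (s b)))"
  by (auto simp: implements_def)

lemma implements_pow:
  assumes "implements c (b + 2) h"
  shows "implements (decode b ;; While (b + 1) (Dec (b + 1) ;; c) ;; move_to (b + 2) b) b
    (\<lambda>x. (h ^^ pfst x) (psnd x))"
proof (rule implementsI)
  fix s :: regs assume s: "\<And>j. j > b \<Longrightarrow> s j = 0"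
  have loop: "big_step (While (b + 1) (Dec (b + 1) ;; c)) t (t(b + 1 := 0, b + 2 :=
      (h ^^ t (b + 1)) (t (b + 2))))"
    if "\<And>j. j > b + 2 \<Longrightarrow> t j = 0" for t
    using that
  proof (induction "t (b + 1)" arbitrary: t)
    case 0
    then have "t = t(b + 1 := 0, b + 2 := (h ^^ t (b + 1)) (t (b + 2)))" by (auto simp: fun_eq_iff)
    then show ?case by (rule big_conv[OF big_While_end[of t "b + 1", OF 0(1)[symmetric]]])
  next
    case (Suc k)
    let ?t = "t(b + 1 := k, b + 2 := h (t (b + 2)))"
    have "big_step (Dec (b + 1) ;; c) t ?t"
      using Suc(2)[symmetric] Suc.prems
      by (intro big_Seq[OF big_Dec] big_conv[OF big_implements[OF assms]]) auto
    moreover have "big_step (While (b + 1) (Dec (b + 1) ;; c)) ?t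
        (t(b + 1 := 0, b + 2 := (h ^^ t (b + 1)) (t (b + 2))))"
      using Suc(2)[symmetric] Suc.prems
      by (intro big_conv[OF Suc(1)[of ?t]]) (auto simp: fun_eq_iff funpow_swap1)
    ultimately show ?case using Suc(2)[symmetric] by (auto intro: big_While_step)
  qed
  show "big_step (decode b ;; While (b + 1) (Dec (b + 1) ;; c) ;; move_to (b + 2) b) s
      (s(b := (h ^^ pfst (s b)) (psnd (s b))))"
    using s by (intro big_Seq[OF big_decode] big_Seq[OF loop] big_conv[OF big_move_to])
      (auto simp: fun_eq_iff)
qed

text \<open>\<open>d\<close> works on the upper copy of the argument and its result is stored in
  \<open>b\<close> before \<open>c\<close> runs, since \<open>c\<close> needs all registers above
  \<open>b + 1\<close> to be zero.\<close>

lemma implements_pair: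
  assumes "implements c (b + 1) f" "implements d (b + 2) g"
  shows "implements (move_both b (b + 1) (b + 2) ;; d ;; move_to (b + 2) b ;; c ;; encode b) b
    (\<lambda>x. prod_encode (f x, g x))"
proof (rule implementsI)
  fix s :: regs assume s: "\<And>j. j > b \<Longrightarrow> s j = 0"
  show "big_step (move_both b (b + 1) (b + 2) ;; d ;; move_to (b + 2) b ;; c ;; encode b) s
      (s(b := prod_encode (f (s b), g (s b))))"
    using s
    by (intro big_Seq[OF big_move_both] big_Seq[OF big_implements[OF assms(2)]]
        big_Seq[OF big_move_to] big_Seq[OF big_implements[OF assms(1)]] big_conv[OF big_encode])
      (auto simp: fun_eq_iff)
qed

lemma prim_rec_implements: "prim_rec f \<Longrightarrow> \<exists>c. implements c b f"
proof (induction arbitrary: b rule: prim_rec.induct)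
  case prim_rec_id
  have "implements (Inc b ;; Dec b) b (\<lambda>x. x)"
    by (rule implementsI, rule big_Seq[OF big_Inc], rule big_conv[OF big_Dec]) auto
  then show ?case by blast
next
  case prim_rec_zero
  have "implements (clear b) b (\<lambda>x. 0)"
    by (rule implementsI, rule big_clear)
  then show ?case by blast
next
  case prim_rec_succ
  have "implements (Inc b) b Suc"
    by (rule implementsI, rule big_Inc)
  then show ?case by blast
next
  case prim_rec_fst
  have "implements (decode b ;; clear (b + 2) ;; move_to (b + 1) b) b pfst"
    by (rule implementsI)
      (intro big_Seq[OF big_decode] big_Seq[OF big_clear] big_conv[OF big_move_to];
        auto simp: fun_eq_iff)
  then show ?case by blast
next
  case prim_rec_snd
  have "implements (decode b ;; clear (b + 1) ;; move_to (b + 2) b) b psnd"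
    by (rule implementsI)
      (intro big_Seq[OF big_decode] big_Seq[OF big_clear] big_conv[OF big_move_to];
        auto simp: fun_eq_iff)
  then show ?case by blast
next
  case (prim_rec_comp f g)
  then obtain c d where c: "implements c b f" and d: "implements d b g" by blast
  have "implements (d ;; c) b (\<lambda>x. f (g x))"
    by (rule implementsI, rule big_Seq[OF big_implements[OF d]], simp,
        rule big_conv[OF big_implements[OF c]]) auto
  then show ?case by blast
next
  case (prim_rec_pair f g)
  obtain c d where "implements c (b + 1) f" "implements d (b + 2) g"
    using prim_rec_pair.IH(1)[of "b + 1"] prim_rec_pair.IH(2)[of "b + 2"] by blast
  from implements_pair[OF this] show ?case by (rule exI)
next
  case (prim_rec_pow h)
  obtain c where "implements c (b + 2) h"
    using prim_rec_pow.IH[of "b + 2"] by blast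
  from implements_pow[OF this] show ?case by (rule exI)
qed

section \<open>Unbounded search\<close>

definition search :: "com \<Rightarrow> com \<Rightarrow> com \<Rightarrow> com" where
  "search tst nx out =
    (let check = move_both 0 1 2 ;; move_to 2 0 ;; tst in
     check ;; While 1 (clear 1 ;; nx ;; check) ;; out)"

text \<open>Success is the value 0, because that is what ends a \<open>While\<close>. The test works
  on a copy in register 1, and this register is cleared before \<open>nx\<close>, which requires
  zeros above register 0.\<close>

lemma big_search:
  assumes "implements tst 1 f" "implements nx 0 g" "implements out 0 h"
    and "\<And>i. i < t \<Longrightarrow> f ((g ^^ i) x) \<noteq> 0" "f ((g ^^ t) x) = 0"
  shows "big_step (search tst nx out) ((\<lambda>_. 0)(0 := x)) ((\<lambda>_. 0)(0 := h ((g ^^ t) x)))"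
proof -
  define check where "check = (move_both 0 1 2 ;; move_to 2 0 ;; tst)"
  have check: "big_step check ((\<lambda>_. 0)(0 := x)) ((\<lambda>_. 0)(0 := x, 1 := f x))" for x
    unfolding check_def
    by (intro big_Seq[OF big_move_both] big_Seq[OF big_move_to] big_conv[OF big_implements[OF
        assms(1)]])
      (auto simp: fun_eq_iff)
  have loop: "big_step (While 1 (clear 1 ;; nx ;; check)) ((\<lambda>_. 0)(0 := x, 1 :=
      f x)) ((\<lambda>_. 0)(0 := (g ^^ t) x))"
    using assms(4,5)
  proof (induction t arbitrary: x)
    case 0
    then show ?case by (intro big_conv[OF big_While_end]) (auto simp: fun_eq_iff)
  next
    case (Suc t)
    have "big_step (clear 1 ;; nx ;; check) ((\<lambda>_. 0)(0 := x, 1 := f x)) ((\<lambda>_. 0)(0 := g x, 1 :=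
        f (g x)))"
    proof (intro big_Seq)
      show "big_step (clear 1) ((\<lambda>_. 0)(0 := x, 1 := f x)) ((\<lambda>_. 0)(0 := x))"
        by (intro big_conv[OF big_clear]) (auto simp: fun_eq_iff)
      show "big_step nx ((\<lambda>_. 0)(0 := x)) ((\<lambda>_. 0)(0 := g x))"
        by (intro big_conv[OF big_implements[OF assms(2)]]) auto
    qed (rule check)
    moreover have "f ((g ^^ i) (g x)) \<noteq> 0" if "i < t" for i
      using Suc.prems(1)[of "Suc i"] that by (simp add: funpow_swap1)
    then have "big_step (While 1 (clear 1 ;; nx ;; check)) ((\<lambda>_. 0)(0 := g x, 1 := f (g x)))
        ((\<lambda>_. 0)(0 := (g ^^ t) (g x)))"
      using Suc.prems(2) by (intro Suc.IH) (auto simp: funpow_swap1)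
    moreover have "((\<lambda>_. 0)(0 := x, 1 := f x)) 1 \<noteq> (0::nat)"
      using Suc.prems(1)[of 0] by simp
    ultimately show ?case
      unfolding funpow_Suc_right comp_def by (rule big_While_step[rotated])
  qed
  have "big_step out ((\<lambda>_. 0)(0 := (g ^^ t) x)) ((\<lambda>_. 0)(0 := h ((g ^^ t) x)))"
    by (rule big_conv[OF big_implements[OF assms(3)]]) auto
  from big_Seq[OF check big_Seq[OF loop this]] show ?thesis
    by (simp only: search_def Let_def check_def)
qed

lemma search_program:
  assumes "prim_rec tst" "prim_rec nx" "prim_rec out" "prim_rec ini"
  shows "\<exists>c. \<forall>y n t.
    (\<forall>i<t. tst ((nx ^^ i) (ini (prod_encode (y, n)))) \<noteq> 0) \<and>
    tst ((nx ^^ t) (ini (prod_encode (y, n)))) = 0 \<longrightarrow>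
    big_step c ((\<lambda>_. 0)(0 := Suc n, 1 := y)) ((\<lambda>_. 0)(0 :=
        out ((nx ^^ t) (ini (prod_encode (y, n))))))"
proof -
  obtain ct cn co ci where c: "implements ct 1 tst" "implements cn 0 nx" "implements co 0 out"
    "implements ci 0 ini"
    using assms[THEN prim_rec_implements] by blast
  \<comment> \<open>\<open>Dec 0\<close> removes the additional one of the input convention;
    \<open>encode 0\<close> makes register 1, the parameter, the first component.\<close>
  have start: "big_step (Dec 0 ;; encode 0 ;; ci) ((\<lambda>_. 0)(0 := Suc n, 1 := y)) ((\<lambda>_. 0)(0 :=
      ini (prod_encode (y, n))))"
    for n y
    by (intro big_Seq[OF big_Dec] big_Seq[OF big_encode] big_conv[OF big_implements[OF c(4)]])
      (auto simp: fun_eq_iff)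
  show ?thesis
  proof (intro exI allI impI, elim conjE)
    fix y n t
    let ?x = "ini (prod_encode (y, n))"
    assume *: "\<forall>i<t. tst ((nx ^^ i) ?x) \<noteq> 0" "tst ((nx ^^ t) ?x) = 0"
    show "big_step ((Dec 0 ;; encode 0 ;; ci) ;; search ct cn co) ((\<lambda>_. 0)(0 := Suc n, 1 := y))
        ((\<lambda>_. 0)(0 := out ((nx ^^ t) ?x)))"
      by (rule big_Seq[OF start big_search[OF c(1-3)]]) (use * in auto)
  qed
qed

section \<open>Arithmetic of codes and simulation of programs\<close>

lemma prim_rec_const: "prim_rec (\<lambda>_. c)"
proof (induction c)
  case (Suc c)
  then show ?case using prim_rec_comp[OF prim_rec_succ, of "\<lambda>_. c"] by simp
qed (rule prim_rec_zero)

named_theorems prim_rec_intros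

declare prim_rec_id [prim_rec_intros] prim_rec_const [prim_rec_intros] prim_rec_pair
    [prim_rec_intros]
declare prim_rec_comp [OF prim_rec_succ, prim_rec_intros] prim_rec_comp [OF prim_rec_fst,
    prim_rec_intros] prim_rec_comp [OF prim_rec_snd, prim_rec_intros]

text \<open>\<open>prim_rec_pow\<close> iterates a fixed function; dependence on \<open>x\<close> is
  obtained by carrying \<open>x\<close> along unchanged in the first component.\<close>

lemma prim_rec_funpow [prim_rec_intros]:
  assumes "prim_rec (\<lambda>z. h (pfst z) (psnd z))" "prim_rec n" "prim_rec i"
  shows "prim_rec (\<lambda>x. (h x ^^ n x) (i x))"
proof -
  define g where "g z = prod_encode (pfst z, h (pfst z) (psnd z))" for z
  have "(g ^^ m) (prod_encode (x, y)) = prod_encode (x, (h x ^^ m) y)" for m x y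
    by (induction m) (simp_all add: g_def)
  moreover have "prim_rec g" unfolding g_def by (intro prim_rec_intros assms)
  then have "prim_rec (\<lambda>x. psnd ((g ^^ pfst (prod_encode (n x, prod_encode (x, i x))))
      (psnd (prod_encode (n x, prod_encode (x, i x))))))"
    by (intro prim_rec_comp[OF prim_rec_snd] prim_rec_comp[OF prim_rec_pow] prim_rec_intros assms)
  ultimately show ?thesis by simp
qed

text \<open>Iterating the constant function with value \<open>h x\<close> leaves \<open>g x\<close>
  after zero rounds and gives \<open>h x\<close> after any other number of rounds.\<close>

lemma prim_rec_if_0:
  assumes "prim_rec f" "prim_rec g" "prim_rec h"
  shows "prim_rec (\<lambda>x. if f x = 0 then g x else h x)"
proof -
  have "((\<lambda>_. h x) ^^ f x) (g x) = (if f x = 0 then g x else h x)" for x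
    by (cases "f x") auto
  moreover have "prim_rec (\<lambda>x. ((\<lambda>_. h x) ^^ f x) (g x))"
    by (intro prim_rec_intros prim_rec_comp[OF assms(3)] assms)
  ultimately show ?thesis by simp
qed

lemma prim_rec_add [prim_rec_intros]: "prim_rec f \<Longrightarrow> prim_rec g \<Longrightarrow> prim_rec (\<lambda>x. f x + g x)"
proof -
  assume "prim_rec f" "prim_rec g"
  then have "prim_rec (\<lambda>x. (Suc ^^ f x) (g x))" by (intro prim_rec_intros)
  then show ?thesis by simp
qed

lemma prim_rec_minus_1 [prim_rec_intros]:
  assumes "prim_rec f" shows "prim_rec (\<lambda>x. f x - 1)"
proof -
  \<comment> \<open>Predecessor by iteration: the second component keeps the previous value of the
    counter.\<close>
  define g where "g z = prod_encode (Suc (pfst z), pfst z)" for z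
  have "(g ^^ n) 0 = prod_encode (n, n - 1)" for n
    by (induction n) (simp_all add: g_def)
  moreover have "prim_rec (\<lambda>x. psnd ((g ^^ f x) 0))" unfolding g_def
      by (intro prim_rec_intros assms)
  ultimately show ?thesis by simp
qed

lemma prim_rec_diff [prim_rec_intros]:
  assumes "prim_rec f" "prim_rec g" shows "prim_rec (\<lambda>x. f x - g x)"
proof -
  have "((\<lambda>y. y - 1) ^^ n) m = m - n" for m n :: nat by (induction n) auto
  moreover have "prim_rec (\<lambda>x. ((\<lambda>y. y - 1) ^^ g x) (f x))" by (intro prim_rec_intros assms)
  ultimately show ?thesis by simp
qed

definition prim_rec_pred :: "(nat \<Rightarrow> bool) \<Rightarrow> bool" where
  "prim_rec_pred P \<longleftrightarrow> prim_rec (\<lambda>x. if P x then 0 else 1)"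

lemma prim_rec_if [prim_rec_intros]:
  assumes "prim_rec_pred P" "prim_rec f" "prim_rec g"
  shows "prim_rec (\<lambda>x. if P x then f x else g x)"
proof -
  have "(if (if P x then 0 else 1) = (0::nat) then f x else g x) = (if P x then f x else g x)" for x
    by simp
  then show ?thesis using prim_rec_if_0[OF assms(1)[unfolded prim_rec_pred_def] assms(2,3)] by simp
qed

lemma prim_rec_pred_eq [prim_rec_intros]:
  assumes "prim_rec f" "prim_rec g" shows "prim_rec_pred (\<lambda>x. f x = g x)"
proof -
  have "prim_rec (\<lambda>x. if (f x - g x) + (g x - f x) = 0 then 0 else 1)"
    by (intro prim_rec_if_0 prim_rec_intros assms)
  moreover have "(f x - g x) + (g x - f x) = 0 \<longleftrightarrow> f x = g x" for x by auto
  ultimately show ?thesis unfolding prim_rec_pred_def by simp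
qed

lemma prim_rec_pred_not [prim_rec_intros]: "prim_rec_pred P \<Longrightarrow> prim_rec_pred (\<lambda>x. \<not> P x)"
proof -
  assume "prim_rec_pred P"
  then have "prim_rec (\<lambda>x. if P x then 1 else 0)" by (intro prim_rec_intros)
  moreover have "(if P x then 1 else 0) = (if \<not> P x then 0 else 1 :: nat)" for x by simp
  ultimately show ?thesis by (simp add: prim_rec_pred_def)
qed

lemma prim_rec_pred_conj [prim_rec_intros]: "prim_rec_pred P \<Longrightarrow> prim_rec_pred Q \<Longrightarrow>
    prim_rec_pred (\<lambda>x. P x \<and> Q x)"
proof -
  assume "prim_rec_pred P" "prim_rec_pred Q"
  then have "prim_rec (\<lambda>x. if P x then if Q x then 0 else 1 else 1)" by (intro prim_rec_intros)
  moreover have "(if P x then if Q x then 0 else 1 else 1) = (if P x \<and> Q x then 0 else 1 :: nat)"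
      for x
    by simp
  ultimately show ?thesis by (simp add: prim_rec_pred_def)
qed

lemma prim_rec_pred_disj [prim_rec_intros]: "prim_rec_pred P \<Longrightarrow> prim_rec_pred Q \<Longrightarrow>
    prim_rec_pred (\<lambda>x. P x \<or> Q x)"
  using prim_rec_pred_not[OF prim_rec_pred_conj[OF prim_rec_pred_not prim_rec_pred_not]] by simp

section \<open>Coded lists\<close>

definition lhd :: "nat \<Rightarrow> nat" where "lhd n = pfst (n - 1)"
definition ltl :: "nat \<Rightarrow> nat" where "ltl n = psnd (n - 1)"
definition lcons :: "nat \<Rightarrow> nat \<Rightarrow> nat" where "lcons a n = Suc (prod_encode (a, n))"

lemma prim_rec_list [prim_rec_intros]:
  "prim_rec f \<Longrightarrow> prim_rec (\<lambda>x. lhd (f x))" "prim_rec f \<Longrightarrow> prim_rec (\<lambda>x. ltl (f x))"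
  "prim_rec f \<Longrightarrow> prim_rec g \<Longrightarrow> prim_rec (\<lambda>x. lcons (f x) (g x))"
  unfolding lhd_def ltl_def lcons_def by (intro prim_rec_intros; assumption)+

text \<open>The values at 0 matter: an exhausted list stays exhausted and reads as 0. This yields
  blanks beyond the written tape, zeros beyond a finite oracle, and surplus loop rounds that do no
  harm.\<close>

lemma list_code_simps [simp]:
  "lhd (list_encode (x # xs)) = x" "ltl (list_encode xs) = list_encode (tl xs)"
  "lhd 0 = 0" "ltl 0 = 0" "lcons x (list_encode xs) = list_encode (x # xs)"
  "list_encode xs = 0 \<longleftrightarrow> xs = []"
  by (cases xs; simp add: lhd_def ltl_def lcons_def)+

lemma lhd_scanned [simp]: "lhd (list_encode r) = scanned r"
  by (cases r) (simp_all add: scanned_def del: list_encode.simps(2))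

declare list_encode.simps(2) [simp del]

text \<open>Allows the code of a list to serve as the number of rounds of a loop through the
  list.\<close>

lemma length_le_list_encode: "length xs \<le> list_encode xs"
proof (induction xs)
  case (Cons x xs)
  then show ?case using le_prod_encode_2[of "list_encode xs" x] by (simp add: list_encode.simps(2))
qed simp

text \<open>The result is the suffix that starts with the matching entry, rather than the entry
  itself, so that 0 can signal that there is none.\<close>

definition lookup :: "nat \<Rightarrow> nat \<Rightarrow> nat" where
  "lookup k p = ((\<lambda>x. if x = 0 \<or> pfst (lhd x) = k then x else ltl x) ^^ p) p"

lemma prim_rec_comp2:
  assumes "prim_rec (\<lambda>z. h (pfst z) (psnd z))" "prim_rec f" "prim_rec g"
  shows "prim_rec (\<lambda>x. h (f x) (g x))"
  using prim_rec_comp[OF assms(1) prim_rec_pair[OF assms(2,3)]] by simp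

lemma prim_rec_comp3:
  assumes "prim_rec (\<lambda>z. h (pfst z) (pfst (psnd z)) (psnd (psnd z)))" "prim_rec f" "prim_rec g"
      "prim_rec k"
  shows "prim_rec (\<lambda>x. h (f x) (g x) (k x))"
  using prim_rec_comp[OF assms(1) prim_rec_pair[OF assms(2) prim_rec_pair[OF assms(3,4)]]] by simp

lemma prim_rec_comp4:
  assumes "prim_rec (\<lambda>z. h (pfst z) (pfst (psnd z)) (pfst (psnd (psnd z))) (psnd (psnd (psnd z))))"
    "prim_rec f" "prim_rec g" "prim_rec k" "prim_rec l"
  shows "prim_rec (\<lambda>x. h (f x) (g x) (k x) (l x))"
  using prim_rec_comp[OF assms(1) prim_rec_pair[OF assms(2) prim_rec_pair[OF assms(3)
      prim_rec_pair[OF assms(4,5)]]]] by simp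

lemma prim_rec_lookup [prim_rec_intros]: "prim_rec f \<Longrightarrow> prim_rec g \<Longrightarrow>
    prim_rec (\<lambda>x. lookup (f x) (g x))"
  by (rule prim_rec_comp2, unfold lookup_def) (intro prim_rec_intros)


lemma lookup_correct:
  "lookup k (list_encode xs) = list_encode (dropWhile (\<lambda>c. pfst c \<noteq> k) xs)"
proof -
  define g where "g x = (if x = 0 \<or> pfst (lhd x) = k then x else ltl x)" for x
  have g0: "g 0 = 0" by (simp add: g_def)
  have fixpoint: "(g ^^ n) x = x" if "g x = x" for n x
    using that by (induction n) simp_all
  have "(g ^^ n) (list_encode xs) = list_encode (dropWhile (\<lambda>c. pfst c \<noteq> k) xs)"
    if "length xs \<le> n" for n xs
    using that
  proof (induction n arbitrary: xs)
    case (Suc n)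
    show ?case
    proof (cases xs)
      case (Cons c cs)
      show ?thesis
      proof (cases "pfst c = k")
        case True
        then have "g (list_encode xs) = list_encode xs" by (simp add: g_def Cons scanned_def)
        then show ?thesis using True Cons by (simp add: fixpoint)
      next
        case False
        then have "g (list_encode xs) = list_encode cs" by (simp add: g_def Cons scanned_def)
        then show ?thesis using False Cons Suc by (simp add: funpow_swap1)
      qed
    qed (simp add: fixpoint[OF g0] del: funpow.simps)
  qed simp
  then show ?thesis
    unfolding lookup_def g_def[abs_def, symmetric] using length_le_list_encode by blast
qed

definition count_ones :: "nat \<Rightarrow> nat" where
  "count_ones l = psnd (((\<lambda>z. prod_encode (ltl (pfst z), if lhd (pfst z) =
      1 then Suc (psnd z) else psnd z)) ^^ l)
     (prod_encode (l, 0)))"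

lemma prim_rec_count_ones [prim_rec_intros]: "prim_rec f \<Longrightarrow> prim_rec (\<lambda>x. count_ones (f x))"
  unfolding count_ones_def by (intro prim_rec_intros)

lemma count_ones_correct [simp]: "count_ones (list_encode xs) = count_list xs 1"
proof -
  define g where "g z = prod_encode (ltl (pfst z), if lhd (pfst z) =
      1 then Suc (psnd z) else psnd z)" for z
  have "(g ^^ n) (prod_encode (list_encode xs, a)) = prod_encode (0, count_list xs 1 + a)"
    if "length xs \<le> n" for n a xs
    using that
  proof (induction n arbitrary: xs a)
    case (Suc n)
    have "(g ^^ Suc n) (prod_encode (list_encode xs, a)) =
        (g ^^ n) (prod_encode (list_encode (tl xs), if scanned xs = 1 then Suc a else a))"
      by (simp add: funpow_swap1 g_def)
    also have "\<dots> = prod_encode (0, count_list (tl xs) 1 + (if scanned xs = 1 then Suc a else a))"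
      using Suc.prems by (intro Suc.IH) simp
    also have "\<dots> = prod_encode (0, count_list xs 1 + a)"
      by (cases xs) (auto simp: scanned_def)
    finally show ?case .
  qed simp
  from this[of xs "list_encode xs" 0] length_le_list_encode[of xs] show ?thesis
    unfolding count_ones_def g_def[abs_def, symmetric] by simp
qed

section \<open>Step-bounded simulation with a finite oracle\<close>

definition oracle_of :: "nat \<Rightarrow> cantor" where
  "oracle_of D k \<longleftrightarrow> lhd ((ltl ^^ k) D) \<noteq> 0"

lemma prim_rec_pred_oracle [prim_rec_intros]: "prim_rec f \<Longrightarrow> prim_rec g \<Longrightarrow>
    prim_rec_pred (\<lambda>x. oracle_of (f x) (g x))"
  unfolding oracle_of_def by (intro prim_rec_intros)

lemma oracle_agrees: "\<exists>D. \<forall>k<m. oracle_of D k = u k"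
proof -
  have *: "(ltl ^^ k) (list_encode xs) = list_encode (drop k xs)" for k xs
    by (induction k) (simp_all add: drop_Suc tl_drop)
  have "oracle_of (list_encode (map (of_bool \<circ> u) [0..<m])) k = u k" if "k < m" for k
    using that by (simp add: oracle_of_def * scanned_def Cons_nth_drop_Suc[symmetric] del:
        list_encode.simps)
  then show ?thesis by blast
qed

definition perform_code :: "nat \<Rightarrow> nat \<Rightarrow> nat \<Rightarrow> nat \<Rightarrow> nat" where
  "perform_code D a l r =
    (if pfst a = 0 then prod_encode (psnd a, prod_encode (ltl l, lcons (lhd l) r))
     else if pfst a = 1 then prod_encode (psnd a, prod_encode (lcons (lhd r) l, ltl r))
     else if pfst a = 2 then
       prod_encode (psnd (psnd a), prod_encode (l, lcons (pfst (psnd a)) (ltl r)))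
     else prod_encode
       (if oracle_of D (count_ones l + count_ones r) then pfst (psnd a) else psnd (psnd a),
        prod_encode (l, r)))"

lemma prim_rec_perform_code [prim_rec_intros]:
  "prim_rec f \<Longrightarrow> prim_rec g \<Longrightarrow> prim_rec h \<Longrightarrow> prim_rec k \<Longrightarrow>
      prim_rec (\<lambda>x. perform_code (f x) (g x) (h x) (k x))"
  unfolding perform_code_def by (intro prim_rec_intros)

definition enc_config :: "config \<Rightarrow> nat" where
  "enc_config c = (case c of (q, l, r) \<Rightarrow> prod_encode (q, prod_encode (list_encode l, list_encode
      r)))"

lemma perform_code_correct:
  "perform_code D a (list_encode l) (list_encode r) =
     enc_config (perform (oracle_of D) (action_of (prod_decode a)) (q, l, r))"
proof -
  obtain k i j where "a = prod_encode (k, prod_encode (i, j))"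
    by (metis prod_encode_pfst_psnd)
  then show ?thesis by (simp add: perform_code_def enc_config_def)
qed

definition entry_for :: "nat \<Rightarrow> nat \<Rightarrow> nat" where
  "entry_for p c = lookup (prod_encode (pfst c, lhd (psnd (psnd c)))) p"

definition step_code :: "nat \<Rightarrow> nat \<Rightarrow> nat \<Rightarrow> nat" where
  "step_code p D c = (if entry_for p c = 0 then c
     else perform_code D (psnd (lhd (entry_for p c))) (pfst (psnd c)) (psnd (psnd c)))"

text \<open>A total form of Kleene's T predicate: 0 if the program has not halted after
  \<open>t\<close> steps, \<open>Suc v\<close> if it has halted with output
  \<open>v\<close>.\<close>

definition result_after :: "nat \<Rightarrow> nat \<Rightarrow> nat \<Rightarrow> nat \<Rightarrow> nat" where
  "result_after p n D t =
     (let c = (step_code p D ^^ t) (prod_encode (0, prod_encode (0, (lcons 1 ^^ Suc n) 0)))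
      in if entry_for p c = 0 then Suc (count_ones (pfst (psnd c)) + count_ones (psnd (psnd c)))
          else 0)"

lemma prim_rec_entry_for [prim_rec_intros]: "prim_rec f \<Longrightarrow> prim_rec g \<Longrightarrow>
    prim_rec (\<lambda>x. entry_for (f x) (g x))"
  unfolding entry_for_def by (intro prim_rec_intros)

lemma prim_rec_step_code [prim_rec_intros]:
  "prim_rec f \<Longrightarrow> prim_rec g \<Longrightarrow> prim_rec h \<Longrightarrow> prim_rec (\<lambda>x. step_code (f x) (g x) (h x))"
  unfolding step_code_def by (intro prim_rec_intros)

lemma prim_rec_result_after [prim_rec_intros]:
  "prim_rec f \<Longrightarrow> prim_rec g \<Longrightarrow> prim_rec h \<Longrightarrow> prim_rec k \<Longrightarrow>
      prim_rec (\<lambda>x. result_after (f x) (g x) (h x) (k x))"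
  by (rule prim_rec_comp4, unfold result_after_def Let_def) (intro prim_rec_intros)

lemma entry_for_correct:
  "entry_for p (enc_config (q, l, r)) = list_encode (dropWhile (\<lambda>c. pfst c \<noteq> prod_encode (q,
      scanned r)) (list_decode p))"
  using lookup_correct[of "prod_encode (q, scanned r)" "list_decode p"]
  by (simp add: entry_for_def enc_config_def)

lemma map_of_program_of:
  "map_of (program_of p) (q, a) =
    (case dropWhile (\<lambda>c. pfst c \<noteq> prod_encode (q, a)) (list_decode p) of [] \<Rightarrow> None
     | c # _ \<Rightarrow> Some (action_of (prod_decode (psnd c))))"
proof -
  have "map_of (map (\<lambda>c. let (k, a) = prod_decode c in (prod_decode k, action_of (prod_decode a)))
      xs) (q, a) =
    (case dropWhile (\<lambda>c. pfst c \<noteq> prod_encode (q, a)) xs of [] \<Rightarrow> None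
     | c # _ \<Rightarrow> Some (action_of (prod_decode (psnd c))))" for xs
  proof (induction xs)
    case (Cons c xs)
    have "prod_decode (pfst c) = (q, a) \<longleftrightarrow> pfst c = prod_encode (q, a)"
      by (metis prod_decode_inverse prod_encode_inverse)
    then show ?case using Cons by (auto simp: pfst_def psnd_def split: prod.splits)
  qed simp
  then show ?thesis by (simp add: program_of_def)
qed

definition step_total :: "nat \<Rightarrow> cantor \<Rightarrow> config \<Rightarrow> config" where
  "step_total p u c = (case step (program_of p) u c of None \<Rightarrow> c | Some c' \<Rightarrow> c')"

lemma step_code_correct: "step_code p D (enc_config c) = enc_config (step_total p (oracle_of D) c)"
proof -
  obtain q l r where c: "c = (q, l, r)" by (cases c)
  have [simp]: "pfst (psnd (enc_config c)) = list_encode l" "psnd (psnd (enc_config c)) =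
      list_encode r"
    by (simp_all add: c enc_config_def)
  define es where "es = dropWhile (\<lambda>c. pfst c \<noteq> prod_encode (q, scanned r)) (list_decode p)"
  have e: "entry_for p (enc_config c) = list_encode es"
    unfolding c es_def by (rule entry_for_correct)
  have m: "map_of (program_of p) (q, scanned r) =
      (case es of [] \<Rightarrow> None | e # _ \<Rightarrow> Some (action_of (prod_decode (psnd e))))"
    unfolding es_def by (rule map_of_program_of)
  show ?thesis
  proof (cases es)
    case Nil
    then have "step_total p (oracle_of D) c = c" using m by (simp add: step_total_def c)
    then show ?thesis using Nil by (simp add: step_code_def e)
  next
    case (Cons a as)
    then have "step_total p (oracle_of D) c = perform (oracle_of D) (action_of (prod_decode (psnd
        a))) c"
      using m by (simp add: step_total_def c)
    then show ?thesis
      using Cons by (simp add: step_code_def e perform_code_correct[where q =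
          q] c[symmetric] scanned_def)
  qed
qed

lemma entry_for_eq_0: "entry_for p (enc_config c) = 0 \<longleftrightarrow> step (program_of p) u c = None"
proof -
  obtain q l r where c: "c = (q, l, r)" by (cases c)
  show ?thesis unfolding c entry_for_correct
    by (cases "dropWhile (\<lambda>c. pfst c \<noteq> prod_encode (q, scanned r)) (list_decode p)")
      (simp_all add: map_of_program_of del: dropWhile_eq_Nil_conv)
qed

definition start :: "nat \<Rightarrow> config" where "start n = (0, [], replicate (Suc n) 1)"

lemma result_after_correct:
  "result_after p n D t = (let c = (step_total p (oracle_of D) ^^ t) (start n)
     in if step (program_of p) (oracle_of D) c = None then Suc (ones c) else 0)"
proof -
  have "(lcons 1 ^^ m) 0 = list_encode (replicate m 1)" for m
    by (induction m) simp_all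
  then have "prod_encode (0, prod_encode (0, (lcons 1 ^^ Suc n) 0)) = enc_config (start n)"
    by (simp add: start_def enc_config_def del: replicate_Suc funpow.simps)
  moreover have "(step_code p D ^^ t) (enc_config c) =
      enc_config ((step_total p (oracle_of D) ^^ t) c)" for c
    by (induction t) (simp_all add: step_code_correct)
  moreover have "count_ones (pfst (psnd (enc_config c))) + count_ones (psnd (psnd (enc_config c)))
      = ones c" for c
    by (cases c) (simp add: enc_config_def)
  ultimately show ?thesis by (simp add: result_after_def Let_def entry_for_eq_0[of _ _
      "oracle_of D"])
qed

lemma run_iff_steps:
  "run p u n = Some v \<longleftrightarrow> (\<exists>t. step (program_of p) u ((step_total p u ^^ t) (start n)) = None \<and>
      ones ((step_total p u ^^ t) (start n)) = v)"
proof -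
  let ?f = "step (program_of p) u" and ?g = "step_total p u"
  have "\<exists>t. ?f ((?g ^^ t) c) = None \<and> ones ((?g ^^ t) c) = v" if "exec ?f c = Some v" for c
  proof (induction ?f c v rule: exec.raw_induct)
    case (1 ex c v)
    show ?case
    proof (cases "?f c")
      case None
      then show ?thesis using 1 by (intro exI[of _ 0]) simp
    next
      case (Some c')
      then obtain t where "?f ((?g ^^ t) c') = None \<and> ones ((?g ^^ t) c') = v"
        using 1 Some by (cases c') force
      then show ?thesis using Some
        by (intro exI[of _ "Suc t"]) (simp add: funpow_swap1 step_total_def)
    qed
  qed (rule that)
  moreover have "exec ?f c = Some (ones ((?g ^^ t) c))" if "?f ((?g ^^ t) c) = None" for t c
    using that
  proof (induction t arbitrary: c)
    case (Suc t)
    then have "exec ?f (?g c) = Some (ones ((?g ^^ t) (?g c)))" by (simp add: funpow_swap1)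
    moreover have "exec ?f (?g c) = exec ?f c"
      by (cases "?f c") (simp_all add: step_total_def exec_step)
    ultimately show ?case by (simp add: funpow_swap1)
  qed (simp add: exec_halt)
  ultimately show ?thesis unfolding run_def start_def by fastforce
qed

lemma steps_after_halt:
  assumes "step (program_of p) u ((step_total p u ^^ t) c) = None" "t \<le> t'"
  shows "(step_total p u ^^ t') c = (step_total p u ^^ t) c"
  using assms(2,1) by (induction t' rule: dec_induct) (auto simp: step_total_def)

lemma result_after_sound: "result_after p n D t = Suc v \<Longrightarrow> run p (oracle_of D) n = Some v"
  by (auto simp: result_after_correct run_iff_steps Let_def split: if_splits)

text \<open>For all large \<open>t\<close>, and not just for one, because several runs will have to
  be finished within the same bound.\<close>

lemma result_after_complete:
  assumes "run p (oracle_of D) n = Some v"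
  shows "\<exists>t0. \<forall>t\<ge>t0. result_after p n D t = Suc v"
proof -
  obtain t0 where t0: "step (program_of p) (oracle_of D) ((step_total p (oracle_of D) ^^ t0)
      (start n)) = None"
    "ones ((step_total p (oracle_of D) ^^ t0) (start n)) = v"
    using assms unfolding run_iff_steps by blast
  have "result_after p n D t = Suc v" if "t0 \<le> t" for t
    using t0 steps_after_halt[OF t0(1) that] by (simp add: result_after_correct)
  then show ?thesis by blast
qed

lemma run_use:
  assumes "run p u n = Some v"
  shows "\<exists>m. \<forall>w. (\<forall>k<m. w k = u k) \<longrightarrow> run p w n = Some v"
proof -
  obtain t where t: "step (program_of p) u ((step_total p u ^^ t) (start n)) = None"
    "ones ((step_total p u ^^ t) (start n)) = v"
    using assms by (auto simp: run_iff_steps)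
  \<comment> \<open>The only oracle position a step can ask about is the number of ones on the tape,
    so \<open>m\<close> exceeds every position queried in the first \<open>t\<close> steps.\<close>
  define m where "m = Suc (Max ((\<lambda>i. ones ((step_total p u ^^ i) (start n))) ` {..t}))"
  have m: "ones ((step_total p u ^^ i) (start n)) < m" if "i \<le> t" for i
    using that by (auto simp: m_def less_Suc_eq_le intro!: Max_ge)
  have local: "step M w c = step M u c" if "w (ones c) = u (ones c)" for M w c
  proof -
    obtain q l r where c: "c = (q, l, r)" by (cases c)
    have "perform w a c = perform u a c" for a using that by (cases a) (auto simp: c)
    then show ?thesis by (simp add: c)
  qed
  have "run p w n = Some v" if w: "\<forall>k<m. w k = u k" for w
  proof -
    have "(step_total p w ^^ i) (start n) = (step_total p u ^^ i) (start n)" if "i \<le> t" for i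
      using that
    proof (induction i)
      case (Suc i)
      let ?c = "(step_total p u ^^ i) (start n)"
      have "step_total p w ?c = step_total p u ?c"
        using local[of w ?c] m[of i] w Suc.prems by (simp only: step_total_def)
      then show ?case using Suc by simp
    qed simp
    then show ?thesis using t local[of w "(step_total p u ^^ t) (start n)"] m[of t] w
      unfolding run_iff_steps by (intro exI[of _ t]) simp
  qed
  then show ?thesis by blast
qed

section \<open>Descriptions of behaviours and self-reference\<close>

text \<open>A description lists the most recent selection at the head, whereas evaluation has to
  begin with the earliest one.\<close>

definition reverse_code :: "nat \<Rightarrow> nat" where
  "reverse_code xs = psnd (((\<lambda>z. if pfst z = 0 then z
     else prod_encode (ltl (pfst z), lcons (lhd (pfst z)) (psnd z))) ^^ xs) (prod_encode (xs, 0)))"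

lemma prim_rec_reverse_code [prim_rec_intros]: "prim_rec f \<Longrightarrow> prim_rec (\<lambda>x. reverse_code (f x))"
  unfolding reverse_code_def by (intro prim_rec_intros)

text \<open>An exhausted list is a fixed point of the loop body, so every number of rounds from the
  length on gives the fold.\<close>

lemma funpow_list_code:
  assumes "\<And>a. g (prod_encode (0, a)) = prod_encode (0, a)"
    "\<And>x xs a. g (prod_encode (list_encode (x # xs), a)) = prod_encode (list_encode xs, h x a)"
  shows "length xs \<le> n \<Longrightarrow> (g ^^ n) (prod_encode (list_encode xs, a)) = prod_encode (0, fold h xs a)"
proof (induction n arbitrary: xs a)
  case (Suc n)
  show ?case
  proof (cases xs)
    case Nil
    have "(g ^^ m) (prod_encode (0, a)) = prod_encode (0, a)" for m
      by (induction m) (simp_all add: assms(1))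
    then show ?thesis using Nil by (simp del: funpow.simps)
  qed (use Suc in \<open>simp add: funpow_swap1 assms(2)\<close>)
qed simp

lemma reverse_code_correct [simp]: "reverse_code (list_encode xs) = list_encode (rev xs)"
proof -
  define g where "g z = (if pfst z = 0 then z
     else prod_encode (ltl (pfst z), lcons (lhd (pfst z)) (psnd z)))" for z
  have "(g ^^ list_encode xs) (prod_encode (list_encode xs, 0)) = prod_encode (0, fold lcons xs 0)"
    by (rule funpow_list_code) (simp_all add: g_def length_le_list_encode scanned_def)
  moreover have "fold lcons xs (list_encode ys) = list_encode (rev xs @ ys)" for ys
    by (induction xs arbitrary: ys) simp_all
  from this[of "[]"] have "fold lcons xs 0 = list_encode (rev xs)" by simp
  ultimately show ?thesis unfolding reverse_code_def g_def[abs_def, symmetric] by simp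
qed

text \<open>A description \<open>prod_encode (p, list_encode js)\<close> denotes the behaviour obtained from
  \<open>run p\<close> by selecting the indices in \<open>js\<close>, the last one first.  Using descriptions avoids
  computing a code of the program \<open>p(i)\<close>, which would need a universal oracle machine.\<close>

primrec selected :: "nat \<Rightarrow> nat list \<Rightarrow> cantor \<Rightarrow> nat option" where
  "selected p [] u = Some p"
| "selected p (i # js) u = Option.bind (selected p js u) (\<lambda>e. run e u i)"

definition behaviour_of :: "nat \<Rightarrow> behaviour" where
  "behaviour_of d u n =
     Option.bind (selected (pfst d) (list_decode (psnd d)) u) (\<lambda>e. run e u n)"

definition program_desc :: "nat \<Rightarrow> nat" where "program_desc p = prod_encode (p, 0)"
definition select_desc :: "nat \<Rightarrow> nat \<Rightarrow> nat" where
  "select_desc d i = prod_encode (pfst d, lcons i (psnd d))"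

lemma behaviour_of_program_desc [simp]: "behaviour_of (program_desc p) = run p"
  by (simp add: behaviour_of_def program_desc_def fun_eq_iff)

lemma behaviour_of_select_desc [simp]:
  "behaviour_of (select_desc d i) = select (behaviour_of d) i"
proof -
  have "list_decode (lcons i x) = i # list_decode x" for x
    by (metis list_code_simps(5) list_decode_inverse list_encode_inverse)
  then show ?thesis
    by (simp add: behaviour_of_def select_desc_def select_def fun_eq_iff)
qed

lemma prim_rec_desc [prim_rec_intros]:
  "prim_rec f \<Longrightarrow> prim_rec (\<lambda>x. program_desc (f x))"
  "prim_rec f \<Longrightarrow> prim_rec g \<Longrightarrow> prim_rec (\<lambda>x. select_desc (f x) (g x))"
  unfolding program_desc_def select_desc_def by (intro prim_rec_intros; assumption)+

definition apply_after :: "nat \<Rightarrow> nat \<Rightarrow> nat \<Rightarrow> nat \<Rightarrow> nat" where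
  "apply_after D t i x = (if x = 0 then 0 else result_after (x - 1) i D t)"

lemma prim_rec_apply_after [prim_rec_intros]:
  "prim_rec f \<Longrightarrow> prim_rec g \<Longrightarrow> prim_rec h \<Longrightarrow> prim_rec k \<Longrightarrow>
      prim_rec (\<lambda>x. apply_after (f x) (g x) (h x) (k x))"
  unfolding apply_after_def by (intro prim_rec_intros)

lemma apply_after_Suc [simp]: "apply_after D t i (Suc e) = result_after e i D t"
  by (simp add: apply_after_def)

lemma apply_after_eq_Suc:
  "apply_after D t i x = Suc v \<longleftrightarrow> (\<exists>e. x = Suc e \<and> result_after e i D t = Suc v)"
  by (cases x) (simp_all add: apply_after_def)

definition desc_after :: "nat \<Rightarrow> nat \<Rightarrow> nat \<Rightarrow> nat \<Rightarrow> nat" where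
  "desc_after d n D t = apply_after D t n
     (psnd (((\<lambda>z. if pfst z = 0 then z
        else prod_encode (ltl (pfst z), apply_after D t (lhd (pfst z)) (psnd z))) ^^ psnd d)
       (prod_encode (reverse_code (psnd d), Suc (pfst d)))))"

lemma prim_rec_desc_after [prim_rec_intros]:
  "prim_rec f \<Longrightarrow> prim_rec g \<Longrightarrow> prim_rec h \<Longrightarrow> prim_rec k \<Longrightarrow>
      prim_rec (\<lambda>x. desc_after (f x) (g x) (h x) (k x))"
  by (rule prim_rec_comp4, unfold desc_after_def) (intro prim_rec_intros)

lemma desc_after_eq:
  "desc_after d n D t = apply_after D t n (foldr (apply_after D t) (list_decode (psnd d)) (Suc
      (pfst d)))"
proof -
  define g where "g z = (if pfst z = 0 then z
     else prod_encode (ltl (pfst z), apply_after D t (lhd (pfst z)) (psnd z)))" for z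
  define js where "js = list_decode (psnd d)"
  have js: "psnd d = list_encode js" by (simp add: js_def)
  have "length (rev js) \<le> list_encode js" using length_le_list_encode[of js] by simp
  then have "(g ^^ list_encode js) (prod_encode (list_encode (rev js), Suc (pfst d))) =
      prod_encode (0, fold (apply_after D t) (rev js) (Suc (pfst d)))"
    by (intro funpow_list_code) (simp_all add: g_def scanned_def)
  then show ?thesis
    unfolding desc_after_def g_def[abs_def, symmetric] js by (simp add: foldr_conv_fold)
qed

lemma selected_sound:
  "foldr (apply_after D t) js (Suc p) = Suc v \<Longrightarrow> selected p js (oracle_of D) = Some v"
proof (induction js arbitrary: v)
  case (Cons i js)
  then obtain e where "foldr (apply_after D t) js (Suc p) = Suc e" "result_after e i D t = Suc v"
    by (auto simp: apply_after_eq_Suc)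
  then show ?case using Cons.IH result_after_sound by simp
qed simp

lemma desc_after_sound: "desc_after d n D t = Suc v \<Longrightarrow> behaviour_of d (oracle_of D) n = Some v"
  \<comment> \<open>Running on input \<open>n\<close> amounts to one more selection, with index
    \<open>n\<close>.\<close>
  using selected_sound[of D t "n # list_decode (psnd d)" "pfst d" v]
  by (simp add: desc_after_eq behaviour_of_def)

lemma selected_complete:
  "selected p js (oracle_of D) = Some v \<Longrightarrow> \<exists>t0. \<forall>t\<ge>t0. foldr (apply_after D t) js (Suc p) = Suc v"
proof (induction js arbitrary: v)
  case (Cons i js)
  then obtain e where e: "selected p js (oracle_of D) = Some e" "run e (oracle_of D) i = Some v"
    by (auto simp: bind_eq_Some_conv)
  obtain t1 where t1: "\<forall>t\<ge>t1. foldr (apply_after D t) js (Suc p) = Suc e"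
    using Cons.IH[OF e(1)] by blast
  obtain t2 where t2: "\<forall>t\<ge>t2. result_after e i D t = Suc v"
    using result_after_complete[OF e(2)] by blast
  show ?case using t1 t2 by (intro exI[of _ "max t1 t2"]) simp
qed simp

lemma desc_after_complete:
  "behaviour_of d (oracle_of D) n = Some v \<Longrightarrow> \<exists>t0. \<forall>t\<ge>t0. desc_after d n D t = Suc v"
  using selected_complete[of "pfst d" "n # list_decode (psnd d)" D v]
  by (simp add: desc_after_eq behaviour_of_def)

lemma selected_use:
  "selected p js u = Some v \<Longrightarrow> \<exists>m. \<forall>w. (\<forall>k<m. w k = u k) \<longrightarrow> selected p js w = Some v"
proof (induction js arbitrary: v)
  case (Cons i js)
  then obtain e where e: "selected p js u = Some e" "run e u i = Some v"
    by (auto simp: bind_eq_Some_conv)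
  obtain m1 where m1: "\<forall>w. (\<forall>k<m1. w k = u k) \<longrightarrow> selected p js w = Some e"
    using Cons.IH[OF e(1)] by blast
  obtain m2 where m2: "\<forall>w. (\<forall>k<m2. w k = u k) \<longrightarrow> run e w i = Some v"
    using run_use[OF e(2)] by blast
  show ?case using m1 m2 by (intro exI[of _ "max m1 m2"]) simp
qed simp

lemma behaviour_of_use:
  "behaviour_of d u n = Some v \<Longrightarrow>
    \<exists>m. \<forall>w. (\<forall>k<m. w k = u k) \<longrightarrow> behaviour_of d w n = Some v"
  using selected_use[of "pfst d" "n # list_decode (psnd d)" u v]
  by (simp add: behaviour_of_def)

section \<open>The s-m-n function and the recursion theorem\<close>

definition loader_code :: "nat \<Rightarrow> nat \<Rightarrow> nat \<Rightarrow> nat" where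
  "loader_code b T y = psnd (((\<lambda>z. prod_encode (Suc (pfst z),
     lcons (prod_encode (prod_encode (b + Suc (pfst z), 0), prod_encode (2, prod_encode (2, b +
         Suc (pfst z)))))
     (lcons (prod_encode (prod_encode (b + Suc (pfst z), 1), prod_encode (2, prod_encode (3, b +
         Suc (pfst z)))))
     (lcons (prod_encode (prod_encode (b + Suc (pfst z), 2), prod_encode (1, b + pfst z)))
     (lcons (prod_encode (prod_encode (b + Suc (pfst z), 3), prod_encode (1, b + pfst z))) (psnd
         z)))))) ^^ y)
     (prod_encode (0, T)))"

text \<open>Here \<open>c\<close> pairs the base state with the code of the tail; the value is the
  code of the \<open>load_program\<close> with parameter \<open>y\<close>.\<close>

definition smn :: "nat \<Rightarrow> nat \<Rightarrow> nat" where
  "smn c y = lcons (prod_encode (prod_encode (0, 1), prod_encode (2, prod_encode (1, pfst c + y))))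
     (loader_code (pfst c) (psnd c) y)"

text \<open>The program \<open>c\<close> with parameter \<open>y\<close> gets its own code as well, as in the recursion
  theorem.\<close>

definition self_app :: "nat \<Rightarrow> nat \<Rightarrow> nat" where
  "self_app c y = smn c (prod_encode (c, y))"

lemma prim_rec_self_app [prim_rec_intros]: "prim_rec f \<Longrightarrow> prim_rec g \<Longrightarrow>
    prim_rec (\<lambda>x. self_app (f x) (g x))"
proof -
  have "prim_rec (\<lambda>z. loader_code (pfst z) (pfst (psnd z)) (psnd (psnd z)))"
    unfolding loader_code_def by (intro prim_rec_intros)
  then have *: "prim_rec f \<Longrightarrow> prim_rec g \<Longrightarrow> prim_rec h \<Longrightarrow>
      prim_rec (\<lambda>x. loader_code (f x) (g x) (h x))" for f g h
    by (rule prim_rec_comp3)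
  show "prim_rec f \<Longrightarrow> prim_rec g \<Longrightarrow> prim_rec (\<lambda>x. self_app (f x) (g x))"
    unfolding self_app_def smn_def by (intro prim_rec_intros *)
qed

lemma smn_correct: "smn (prod_encode (b, enc_program T)) y = enc_program (load_program b T y)"
proof -
  have "loader_code b (enc_program T) y = enc_program (loader b T y)"
  proof -
    define g where "g z = prod_encode (Suc (pfst z),
     lcons (prod_encode (prod_encode (b + Suc (pfst z), 0), prod_encode (2, prod_encode (2, b +
         Suc (pfst z)))))
     (lcons (prod_encode (prod_encode (b + Suc (pfst z), 1), prod_encode (2, prod_encode (3, b +
         Suc (pfst z)))))
     (lcons (prod_encode (prod_encode (b + Suc (pfst z), 2), prod_encode (1, b + pfst z)))
     (lcons (prod_encode (prod_encode (b + Suc (pfst z), 3), prod_encode (1, b + pfst z))) (psnd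
         z)))))" for z
    have "(g ^^ y) (prod_encode (0, enc_program T)) = prod_encode (y, enc_program (loader b T y))"
      by (induction y) (simp_all add: g_def enc_program_def)
    then show ?thesis unfolding loader_code_def g_def[abs_def, symmetric] by simp
  qed
  then show ?thesis by (simp add: smn_def enc_program_def load_program_def)
qed

text \<open>There is no circle: \<open>tst\<close> and \<open>out\<close> are fixed before
  \<open>c\<close>, which is built from them. At run time they find \<open>c\<close> in their
  argument and can compute \<open>self_app c y\<close> for every \<open>y\<close>, hence the code of
  each program in the family, including the running one.\<close>

lemma search_recursion:
  assumes "prim_rec tst" "prim_rec out"
  shows "\<exists>c. \<forall>y. ordinary (self_app c y) \<and> (\<forall>n. (\<exists>t. tst (prod_encode (prod_encode (prod_encode
      (c, y), n), t)) = 0) \<longrightarrow>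
    (\<exists>t. tst (prod_encode (prod_encode (prod_encode (c, y), n), t)) = 0 \<and>
      (\<forall>u. run (self_app c y) u n = Some (out (prod_encode (prod_encode (prod_encode (c, y), n),
          t))))))"
proof -
  define nx where "nx w = prod_encode (pfst w, Suc (psnd w))" for w
  define ini where "ini x = prod_encode (x, 0)" for x
  have nx: "(nx ^^ t) (ini x) = prod_encode (x, t)" for t x
    by (induction t) (simp_all add: nx_def ini_def)
  have "prim_rec nx" "prim_rec ini" unfolding nx_def ini_def by (intro prim_rec_intros)+
  then obtain com where com: "\<And>y n t. \<forall>i<t. tst (prod_encode (prod_encode (y, n), i)) \<noteq> 0 \<Longrightarrow>
      tst (prod_encode (prod_encode (y, n), t)) = 0 \<Longrightarrow>
      big_step com ((\<lambda>_. 0)(0 := Suc n, 1 := y)) ((\<lambda>_. 0)(0 :=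
          out (prod_encode (prod_encode (y, n), t))))"
    using search_program[of tst nx out ini] assms unfolding nx by blast
  define R where "R = max 2 (width com)"
  define c where "c = prod_encode (load_base com, enc_program (load_tail R com))"
  have sa: "self_app c y = enc_program (load_program (load_base com) (load_tail R com)
      (prod_encode (c, y)))" for y
    unfolding self_app_def by (subst c_def) (rule smn_correct)
  have "\<exists>t. tst (prod_encode (prod_encode (prod_encode (c, y), n), t)) = 0 \<and>
      (\<forall>u. run (self_app c y) u n = Some (out (prod_encode (prod_encode (prod_encode (c, y), n),
          t))))"
    if "tst (prod_encode (prod_encode (prod_encode (c, y), n), t)) = 0" for y n t
  proof -
    define P where "P t \<longleftrightarrow> tst (prod_encode (prod_encode (prod_encode (c, y), n), t)) = 0" for t
    define t0 where "t0 = (LEAST t. P t)"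
    have "P t" using that by (simp add: P_def)
    then have "P t0" "\<forall>i<t0. \<not> P i" unfolding t0_def using LeastI not_less_Least by blast+
    then show ?thesis
      using run_load_program[OF com[of t0 "prod_encode (c, y)" n], of R]
      by (intro exI[of _ t0]) (auto simp: sa P_def R_def)
  qed
  moreover have "ordinary (self_app c y)" for y
    unfolding sa by (rule ordinary_load_program)
  ultimately show ?thesis by blast
qed

section \<open>Translation of realisers\<close>

text \<open>The direction \<open>k\<close> is 0 from Kleene to \<open>F\<close>-realisers and 1 for
  the way back, so \<open>1 - k\<close> reverses it. The description \<open>d\<close> stands for the
  given realiser and \<open>f\<close> for the code of the formula.\<close>

definition translate :: "nat \<Rightarrow> nat \<Rightarrow> nat \<Rightarrow> nat \<Rightarrow> nat" where
  "translate c k d f = self_app c (prod_encode (k, prod_encode (d, f)))"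

lemma prim_rec_translate [prim_rec_intros]:
  "prim_rec f \<Longrightarrow> prim_rec g \<Longrightarrow> prim_rec h \<Longrightarrow> prim_rec l \<Longrightarrow>
      prim_rec (\<lambda>x. translate (f x) (g x) (h x) (l x))"
  unfolding translate_def by (intro prim_rec_intros)

text \<open>To produce its output on input \<open>n\<close>, a translated realiser of the formula with code
  \<open>f\<close> runs the given one on the inputs \<open>query c k f n 0\<close> and \<open>query c k f n 1\<close>.\<close>

definition query :: "nat \<Rightarrow> nat \<Rightarrow> nat \<Rightarrow> nat \<Rightarrow> nat \<Rightarrow> nat" where
  "query c k f n i =
    (if pfst f = 4 then translate c (1 - k) (program_desc n) (pfst (psnd f))
     else if pfst f = 6 then n else i)"

lemma prim_rec_query [prim_rec_intros]:
  "prim_rec c \<Longrightarrow> prim_rec k \<Longrightarrow> prim_rec f \<Longrightarrow> prim_rec n \<Longrightarrow> prim_rec i \<Longrightarrow>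
      prim_rec (\<lambda>x. query (c x) (k x) (f x) (n x) (i x))"
  unfolding query_def by (intro prim_rec_intros)

text \<open>Tags 3 to 6 belong to \<open>Disj\<close>, \<open>Impl\<close>, \<open>Exists\<close>
  and \<open>Forall\<close>. A conjunction has to be answered without a run: its clause for
  \<open>F\<close> does not demand that the program halts on 0 and 1, so a search might never end.
  Its components are passed on as unevaluated descriptions instead.\<close>

definition needs_query :: "nat \<Rightarrow> bool" where
  "needs_query f \<longleftrightarrow> pfst f = 3 \<or> pfst f = 4 \<or> pfst f = 5 \<or> pfst f = 6"

lemma prim_rec_needs_query [prim_rec_intros]: "prim_rec f \<Longrightarrow> prim_rec_pred (\<lambda>x. needs_query (f x))"
  unfolding needs_query_def by (intro prim_rec_intros)

text \<open>For \<open>Impl\<close> and \<open>Forall\<close> both queries coincide and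
  \<open>w\<close> is the output. The conclusion of an implication, the body of a quantifier and the
  right disjunct all sit at \<open>psnd (psnd f)\<close>.\<close>

definition answer :: "nat \<Rightarrow> nat \<Rightarrow> nat \<Rightarrow> nat \<Rightarrow> nat \<Rightarrow> nat \<Rightarrow> nat" where
  "answer c k f n v w =
    (if (pfst f = 3 \<or> pfst f = 5) \<and> n = 0 then v
     else translate c k (program_desc w)
       (if pfst f = 3 \<and> v = 0 then pfst (psnd f) else psnd (psnd f)))"

lemma prim_rec_answer [prim_rec_intros]:
  "prim_rec c \<Longrightarrow> prim_rec k \<Longrightarrow> prim_rec f \<Longrightarrow> prim_rec n \<Longrightarrow> prim_rec v \<Longrightarrow> prim_rec w \<Longrightarrow>
    prim_rec (\<lambda>x. answer (c x) (k x) (f x) (n x) (v x) (w x))"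
  unfolding answer_def by (intro prim_rec_intros)

text \<open>The tag 7, which codes no formula, is used for the programs that map a realiser and
  a formula to the translated realiser.\<close>

definition outcome :: "nat \<Rightarrow> nat \<Rightarrow> nat \<Rightarrow> nat \<Rightarrow> nat \<Rightarrow> nat \<Rightarrow> nat \<Rightarrow> nat" where
  "outcome c k d f n v w =
    (if pfst f = 2 then
       translate c k (select_desc d n) (if n = 0 then pfst (psnd f) else psnd (psnd f))
     else if pfst f = 7 then translate c k (program_desc (pfst n)) (psnd n)
     else answer c k f n v w)"

lemma prim_rec_outcome [prim_rec_intros]:
  "prim_rec c \<Longrightarrow> prim_rec k \<Longrightarrow> prim_rec d \<Longrightarrow> prim_rec f \<Longrightarrow> prim_rec n \<Longrightarrow> prim_rec v \<Longrightarrow> prim_rec w \<Longrightarrow>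
    prim_rec (\<lambda>x. outcome (c x) (k x) (d x) (f x) (n x) (v x) (w x))"
  unfolding outcome_def by (intro prim_rec_intros)

text \<open>The interface between machines and realisability. In \<open>run_query\<close> both
  answers come from one oracle, which may differ from the halting one supplied: the search stops at
  its earliest success.\<close>

locale translator =
  fixes c :: nat
  assumes ordinary_translate: "ordinary (translate c k d f)"
    and run_immediate: "\<not> needs_query f \<Longrightarrow>
      \<exists>v w. run (translate c k d f) u n = Some (outcome c k d f n v w)"
    and run_query: "needs_query f \<Longrightarrow>
      behaviour_of d (oracle_of D) (query c k f n 0) \<noteq> None \<Longrightarrow>
      behaviour_of d (oracle_of D) (query c k f n 1) \<noteq> None \<Longrightarrow>
      \<exists>D v w. behaviour_of d (oracle_of D) (query c k f n 0) = Some v \<and>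
        behaviour_of d (oracle_of D) (query c k f n 1) = Some w \<and>
        (\<forall>u. run (translate c k d f) u n = Some (outcome c k d f n v w))"

lemma ex_translator: "\<exists>c. translator c"
proof -
  \<comment> \<open>The search sees \<open>(((c, y), n), t)\<close>, where the parameter
    \<open>y\<close> is \<open>(k, (d, f))\<close> and \<open>t\<close> consists of a finite oracle
    and a step bound.\<close>
  define c_of where "c_of z = pfst (pfst (pfst z))" for z
  define k_of where "k_of z = pfst (psnd (pfst (pfst z)))" for z
  define d_of where "d_of z = pfst (psnd (psnd (pfst (pfst z))))" for z
  define f_of where "f_of z = psnd (psnd (psnd (pfst (pfst z))))" for z
  define n_of where "n_of z = psnd (pfst z)" for z
  define res where "res z i = desc_after (d_of z) (query (c_of z) (k_of z) (f_of z) (n_of z) i)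
    (pfst (psnd z)) (psnd (psnd z))" for z i
  define tst where "tst z = (if needs_query (f_of z) \<and> (res z 0 = 0 \<or> res z 1 =
      0) then 1 else 0 :: nat)" for z
  define out where "out z = outcome (c_of z) (k_of z) (d_of z) (f_of z) (n_of z) (res z 0 - 1)
      (res z 1 - 1)" for z
  note defs = c_of_def k_of_def d_of_def f_of_def n_of_def res_def
  have prim_rec_of: "prim_rec c_of" "prim_rec k_of" "prim_rec d_of" "prim_rec f_of" "prim_rec n_of"
    unfolding defs[abs_def] by (intro prim_rec_intros)+
  have prim_rec_res: "prim_rec (\<lambda>z. res z i)" for i
    unfolding res_def by (intro prim_rec_intros prim_rec_of)
  have "prim_rec tst" "prim_rec out"
    unfolding tst_def out_def by (intro prim_rec_intros prim_rec_of prim_rec_res)+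
  then obtain c where c: "\<And>y. ordinary (self_app c y)"
    "\<And>y n t. tst (prod_encode (prod_encode (prod_encode (c, y), n), t)) = 0 \<Longrightarrow>
      \<exists>t. tst (prod_encode (prod_encode (prod_encode (c, y), n), t)) = 0 \<and>
      (\<forall>u. run (self_app c y) u n = Some (out (prod_encode (prod_encode (prod_encode (c, y), n),
          t))))"
    using search_recursion[of tst out] by blast
  have "translator c"
  proof
    show "ordinary (translate c k d f)" for k d f
      unfolding translate_def by (rule c)
    fix f k d n
    let ?z = "\<lambda>t. prod_encode (prod_encode (prod_encode (c, prod_encode (k, prod_encode (d, f))),
        n), t)"
    have z: "c_of (?z t) = c" "k_of (?z t) = k" "d_of (?z t) = d" "f_of (?z t) = f" "n_of (?z t) =
        n" for t
      by (simp_all add: defs)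
    have run: "\<exists>t. tst (?z t) = 0 \<and> (\<forall>u. run (translate c k d f) u n =
        Some (outcome c k d f n (res (?z t) 0 - 1) (res (?z t) 1 - 1)))" if "tst (?z t) = 0" for t
      using c(2)[OF that] unfolding translate_def out_def z .
    show "\<exists>v w. run (translate c k d f) u n = Some (outcome c k d f n v w)" if "\<not> needs_query f"
        for u
      using run[of 0] that by (auto simp: tst_def z)
    show "\<exists>D v w. behaviour_of d (oracle_of D) (query c k f n 0) = Some v \<and>
        behaviour_of d (oracle_of D) (query c k f n 1) = Some w \<and>
        (\<forall>u. run (translate c k d f) u n = Some (outcome c k d f n v w))"
      if f: "needs_query f" and halt: "behaviour_of d (oracle_of D) (query c k f n 0) \<noteq> None"
        "behaviour_of d (oracle_of D) (query c k f n 1) \<noteq> None" for D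
    proof -
      obtain v w where "behaviour_of d (oracle_of D) (query c k f n 0) = Some v"
        "behaviour_of d (oracle_of D) (query c k f n 1) = Some w"
        using halt by blast
      then obtain t0 t1 where t: "\<forall>t\<ge>t0. desc_after d (query c k f n 0) D t = Suc v"
        "\<forall>t\<ge>t1. desc_after d (query c k f n 1) D t = Suc w"
        by (meson desc_after_complete)
      have "tst (?z (prod_encode (D, max t0 t1))) = 0"
        using t by (simp add: tst_def res_def z)
      then obtain t where t: "tst (?z t) = 0" "\<forall>u. run (translate c k d f) u n =
        Some (outcome c k d f n (res (?z t) 0 - 1) (res (?z t) 1 - 1))"
        using run by blast
      have "res (?z t) 0 \<noteq> 0" "res (?z t) 1 \<noteq> 0"
        using t(1) f by (auto simp: tst_def z split: if_splits)
      then obtain v w where vw: "res (?z t) 0 = Suc v" "res (?z t) 1 = Suc w"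
        by (meson not0_implies_Suc)
      then have "behaviour_of d (oracle_of (pfst t)) (query c k f n 0) = Some v"
        "behaviour_of d (oracle_of (pfst t)) (query c k f n 1) = Some w"
        by (auto simp: res_def z intro!: desc_after_sound)
      then show ?thesis using t(2) vw by auto
    qed
  qed
  then show ?thesis ..
qed

section \<open>Translated realisers and co-interval-free sets\<close>

lemma co_interval_free_meets:
  assumes "co_interval_free X"
  shows "\<exists>w\<in>X. \<forall>k<m. w k = u k"
proof -
  have "\<not> cylinder (map u [0..<m]) \<subseteq> - X"
    using assms by (simp add: co_interval_free_def interval_free_def)
  then show ?thesis by (auto simp: cylinder_def)
qed

context translator
begin

text \<open>The use principle is applied twice. From a member \<open>u\<close> of \<open>X\<close>
  it passes to a finite oracle that need not lie in \<open>X\<close>, so the search ends. From the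
  oracle at which it ends, possibly an unrelated one, it passes back to a member of
  \<open>X\<close>, where the clauses of \<open>F\<close>-realisability speak about the
  answers.\<close>

lemma run_query_co_interval_free:
  assumes X: "co_interval_free X" and f: "needs_query f"
    and halt: "\<And>u. u \<in> X \<Longrightarrow> behaviour_of d u (query c k f n 0) \<noteq> None \<and>
        behaviour_of d u (query c k f n 1) \<noteq> None"
  shows "\<exists>u\<in>X. \<exists>v w. behaviour_of d u (query c k f n 0) = Some v \<and>
    behaviour_of d u (query c k f n 1) = Some w \<and>
    (\<forall>u. run (translate c k d f) u n = Some (outcome c k d f n v w))"
proof -
  let ?f = "\<lambda>u i. behaviour_of d u (query c k f n i)"
  have use: "\<exists>m. \<forall>w. (\<forall>k<m. w k = u k) \<longrightarrow> ?f w 0 = Some a \<and> ?f w 1 = Some b"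
    if ab: "?f u 0 = Some a" "?f u 1 = Some b" for u a b
  proof -
    obtain m1 where "\<forall>w. (\<forall>k<m1. w k = u k) \<longrightarrow> ?f w 0 = Some a"
      using behaviour_of_use[OF ab(1)] by blast
    moreover obtain m2 where "\<forall>w. (\<forall>k<m2. w k = u k) \<longrightarrow> ?f w 1 = Some b"
      using behaviour_of_use[OF ab(2)] by blast
    ultimately show ?thesis by (intro exI[of _ "max m1 m2"]) simp
  qed
  obtain u where u: "u \<in> X" using co_interval_free_meets[OF X, of 0] by auto
  with halt obtain a b where "?f u 0 = Some a" "?f u 1 = Some b" by blast
  from use[OF this] obtain m where m: "\<forall>w. (\<forall>k<m. w k = u k) \<longrightarrow> ?f w 0 = Some a \<and> ?f w 1 = Some b"
    by blast
  obtain D where "\<forall>k<m. oracle_of D k = u k" using oracle_agrees by blast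
  with m have "?f (oracle_of D) 0 \<noteq> None" "?f (oracle_of D) 1 \<noteq> None" by simp_all
  from run_query[OF f this] obtain D v w where D: "?f (oracle_of D) 0 = Some v"
    "?f (oracle_of D) 1 = Some w" "\<forall>u. run (translate c k d f) u n = Some (outcome c k d f n v w)"
    by blast
  from use[OF D(1,2)] obtain m where m:
    "\<forall>x. (\<forall>k<m. x k = oracle_of D k) \<longrightarrow> ?f x 0 = Some v \<and> ?f x 1 = Some w" by blast
  obtain x where "x \<in> X" "\<forall>k<m. x k = oracle_of D k"
    using co_interval_free_meets[OF X, of m "oracle_of D"] by blast
  with m D(3) show ?thesis by blast
qed

definition tr :: "nat \<Rightarrow> nat \<Rightarrow> fm \<Rightarrow> nat" where
  "tr k d \<phi> = translate c k d (fm_code \<phi>)"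

lemma ordinary_tr [simp]: "ordinary (tr k d \<phi>)"
  by (simp add: tr_def ordinary_translate)

lemma run_entry:
  "run (translate c k d (prod_encode (7, 0))) u (prod_encode (p, fm_code \<phi>)) =
      Some (tr k (program_desc p) \<phi>)"
  using run_immediate[of "prod_encode (7, 0)" k d u "prod_encode (p, fm_code \<phi>)"]
  by (simp add: needs_query_def outcome_def tr_def)

lemma run_tr_Conj:
  "run (tr k d (Conj \<phi> \<psi>)) u n = Some (tr k (select_desc d n) (if n = 0 then \<phi> else \<psi>))"
  using run_immediate[of "fm_code (Conj \<phi> \<psi>)" k d u n]
  by (simp add: needs_query_def outcome_def tr_def)

lemma run_tr_Disj:
  assumes "co_interval_free X" "\<And>u. u \<in> X \<Longrightarrow> behaviour_of d u 0 \<noteq> None \<and> behaviour_of d u 1 \<noteq> None"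
  shows "\<exists>u\<in>X. \<exists>v w. behaviour_of d u 0 = Some v \<and> behaviour_of d u 1 = Some w \<and>
    (\<forall>u. run (tr k d (Disj \<phi> \<psi>)) u n =
      Some (if n = 0 then v else tr k (program_desc w) (if v = 0 then \<phi> else \<psi>)))"
proof -
  have o: "outcome c k d (fm_code (Disj \<phi> \<psi>)) n v w =
      (if n = 0 then v else tr k (program_desc w) (if v = 0 then \<phi> else \<psi>))" for v w
    by (simp add: outcome_def answer_def tr_def)
  have q: "query c k (fm_code (Disj \<phi> \<psi>)) n i = i" and nq: "needs_query (fm_code (Disj \<phi> \<psi>))" for i
    by (simp_all add: query_def needs_query_def)
  show ?thesis
    using run_query_co_interval_free[OF assms(1) nq, of d k n, unfolded q o, folded tr_def] assms(2)
    by blast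
qed

lemma run_tr_Exists:
  assumes "co_interval_free X" "\<And>u. u \<in> X \<Longrightarrow> behaviour_of d u 0 \<noteq> None \<and> behaviour_of d u 1 \<noteq> None"
  shows "\<exists>u\<in>X. \<exists>v w. behaviour_of d u 0 = Some v \<and> behaviour_of d u 1 = Some w \<and>
    (\<forall>u. run (tr k d (Exists x \<phi>)) u n = Some (if n = 0 then v else tr k (program_desc w) \<phi>))"
  using run_query_co_interval_free[OF assms(1), of "fm_code (Exists x \<phi>)" d k n] assms(2)
  by (simp add: needs_query_def outcome_def tr_def query_def answer_def cong: if_cong)

lemma run_tr_Impl:
  assumes "co_interval_free X" "\<And>u. u \<in> X \<Longrightarrow> behaviour_of d u (tr (1 - k) (program_desc n) \<phi>) \<noteq> None"
  shows "\<exists>u\<in>X. \<exists>v. behaviour_of d u (tr (1 - k) (program_desc n) \<phi>) = Some v \<and>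
    (\<forall>u. run (tr k d (Impl \<phi> \<psi>)) u n = Some (tr k (program_desc v) \<psi>))"
  using run_query_co_interval_free[OF assms(1), of "fm_code (Impl \<phi> \<psi>)" d k n] assms(2)
  by (auto simp add: needs_query_def outcome_def tr_def query_def answer_def)

lemma run_tr_Forall:
  assumes "co_interval_free X" "\<And>u. u \<in> X \<Longrightarrow> behaviour_of d u n \<noteq> None"
  shows "\<exists>u\<in>X. \<exists>v. behaviour_of d u n = Some v \<and>
    (\<forall>u. run (tr k d (Forall x \<phi>)) u n = Some (tr k (program_desc v) \<phi>))"
  using run_query_co_interval_free[OF assms(1), of "fm_code (Forall x \<phi>)" d k n] assms(2)
  by (auto simp add: needs_query_def outcome_def tr_def query_def answer_def)

end

text \<open>The translation looks only at the logical structure of a formula, which instantiation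
  leaves unchanged; hence it never has to substitute numerals.\<close>

primrec skeleton :: "fm \<Rightarrow> fm" where
  "skeleton Falsum = Falsum"
| "skeleton (Equ t s) = Equ Zero Zero"
| "skeleton (Conj \<phi> \<psi>) = Conj (skeleton \<phi>) (skeleton \<psi>)"
| "skeleton (Disj \<phi> \<psi>) = Disj (skeleton \<phi>) (skeleton \<psi>)"
| "skeleton (Impl \<phi> \<psi>) = Impl (skeleton \<phi>) (skeleton \<psi>)"
| "skeleton (Exists x \<phi>) = Exists 0 (skeleton \<phi>)"
| "skeleton (Forall x \<phi>) = Forall 0 (skeleton \<phi>)"

lemma skeleton_inst [simp]: "skeleton (inst x n \<phi>) = skeleton \<phi>"
  by (induction \<phi>) auto

section \<open>Correctness of both translations\<close>

lemma realises_ordinary: "realises e \<phi> \<Longrightarrow> ordinary e"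
  by (cases \<phi>) auto

text \<open>The program carries the code of \<open>\<theta>\<close>, whose quantified bodies are
  never instantiated, but has to realise the instance \<open>\<phi>\<close>; both have the same
  skeleton. Induction is on depth since instances are not subformulas, and both directions are
  proved together because each uses the other at an implication.\<close>

lemma (in translator) tr_correct:
  assumes F: "F \<noteq> {}" "\<And>X. X \<in> F \<Longrightarrow> co_interval_free X"
  shows "skeleton \<theta> = skeleton \<phi> \<Longrightarrow>
    (\<forall>e d. realises e \<phi> \<longrightarrow> behaviour_of d = run e \<longrightarrow> F_realises F (tr 0 d \<theta>) \<phi>) \<and>
    (\<forall>d. F_realises_beh F (behaviour_of d) \<phi> \<longrightarrow> realises (tr 1 d \<theta>) \<phi>)"
proof (induction "depth \<phi>" arbitrary: \<phi> \<theta> rule: less_induct)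
  case less
  have to_F: "F_realises_beh F (run (tr 0 d \<theta>')) \<phi>'"
    if "depth \<phi>' < depth \<phi>" "skeleton \<theta>' = skeleton \<phi>'" "realises e \<phi>'" "behaviour_of d = run e"
        for \<phi>' \<theta>' e d
    using less(1)[OF that(1,2)] that(3,4) by (auto simp: F_realises_def)
  have from_F: "realises (tr 1 d \<theta>') \<phi>'"
    if "depth \<phi>' < depth \<phi>" "skeleton \<theta>' = skeleton \<phi>'" "F_realises_beh F (behaviour_of d) \<phi>'"
        for \<phi>' \<theta>' d
    using less(1)[OF that(1,2)] that(3) by auto
  note from_F = from_F from_F[unfolded One_nat_def]
  have ro: "run_ordinary (tr k d \<phi>) n = run (tr k d \<phi>) (\<lambda>_. False) n" for k d \<phi> n
    by (simp add: run_ordinary_def)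
  \<comment> \<open>An ordinary realiser answers alike under all oracles, so any member of
    \<open>F\<close> can be the witness in the clauses towards \<open>F\<close>.\<close>
  obtain X0 where X0: "X0 \<in> F" "co_interval_free X0" using F by blast
  show ?case
  proof (cases \<phi>)
    case Falsum
    then show ?thesis by simp
  next
    case (Equ t s)
    then show ?thesis by (simp add: F_realises_def)
  next
    case (Conj a b)
    then obtain a' b' where \<theta>: "\<theta> = Conj a' b'" "skeleton a' = skeleton a" "skeleton b' =
        skeleton b"
      using less(2) by (cases \<theta>) auto
    have sel: "select (run (tr k d \<theta>)) i = run (tr k (select_desc d i) (if i =
        0 then a' else b'))" for k d i
      by (simp add: select_def run_tr_Conj \<theta> fun_eq_iff)
    have "F_realises F (tr 0 d \<theta>) \<phi>" if e: "realises e \<phi>" "behaviour_of d = run e" for e d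
    proof -
      \<comment> \<open>Since \<open>e\<close> is ordinary, its output on \<open>i\<close> is one
        program \<open>e'\<close> for all oracles.\<close>
      have "select (run e) i = run e'" if "run_ordinary e i = Some e'" for i e'
        using that run_ordinary_eq_run[OF realises_ordinary[OF e(1)]]
        by (simp add: select_def fun_eq_iff)
      then show ?thesis using e Conj \<theta>(2,3)
        by (auto simp: F_realises_def sel intro!: to_F)
    qed
    moreover have "realises (tr 1 d \<theta>) \<phi>" if "F_realises_beh F (behaviour_of d) \<phi>" for d
      using that Conj \<theta>(2,3) by (auto simp: ro \<theta>(1) run_tr_Conj intro!: from_F)
    ultimately show ?thesis by blast
  next
    case (Disj a b)
    then obtain a' b' where \<theta>: "\<theta> = Disj a' b'" "skeleton a' = skeleton a" "skeleton b' =
        skeleton b"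
      using less(2) by (cases \<theta>) auto
    have "F_realises F (tr 0 d \<theta>) \<phi>" if e: "realises e \<phi>" "behaviour_of d = run e" for e d
    proof -
      obtain i e' where e': "i < 2" "run_ordinary e 0 = Some i" "run_ordinary e 1 = Some e'"
        "if i = 0 then realises e' a else realises e' b"
        using e(1) Disj by auto
      then have d: "behaviour_of d u 0 = Some i" "behaviour_of d u 1 = Some e'" for u
        using run_ordinary_eq_run[OF realises_ordinary[OF e(1)]] e(2) by simp_all
      have "run (tr 0 d \<theta>) u n = Some (if n = 0 then i else tr 0 (program_desc e') (if i =
          0 then a' else b'))" for u n
        using run_tr_Disj[OF X0(2), of d 0 a' b' n] d \<theta>(1) by auto
      then show ?thesis using e'(1,4) X0(1) Disj \<theta>(2,3)
        by (auto simp: F_realises_def intro!: bexI[of _ X0] exI[of _ i] to_F)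
    qed
    moreover have "realises (tr 1 d \<theta>) \<phi>" if d: "F_realises_beh F (behaviour_of d) \<phi>" for d
    proof -
      obtain X i where X: "X \<in> F" "i < 2" "\<And>u. u \<in> X \<Longrightarrow> behaviour_of d u 0 = Some i \<and>
        (\<exists>q. behaviour_of d u 1 = Some q \<and>
           (if i = 0 then F_realises_beh F (run q) a else F_realises_beh F (run q) b))"
        using d unfolding Disj by auto
      \<comment> \<open>The searches for different \<open>n\<close> may lead to different members of
        \<open>X\<close>, but the tag \<open>i\<close> is constant on \<open>X\<close>, so the
        realiser found fits the tag announced.\<close>
      have "\<exists>q. (\<forall>u. run (tr 1 d \<theta>) u n = Some (if n = 0 then i else tr 1 (program_desc q) (if i =
          0 then a' else b'))) \<and>
          (if i = 0 then F_realises_beh F (run q) a else F_realises_beh F (run q) b)" for n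
        using run_tr_Disj[OF F(2)[OF X(1)], of d 1 a' b' n] X(3) \<theta>(1) by fastforce
      from this[of 0] this[of 1] show ?thesis using X(2) Disj \<theta>(2,3)
        by (cases "i = 0") (auto simp: ro intro!: from_F)
    qed
    ultimately show ?thesis by blast
  next
    case (Impl a b)
    then obtain a' b' where \<theta>: "\<theta> = Impl a' b'" "skeleton a' = skeleton a" "skeleton b' =
        skeleton b"
      using less(2) by (cases \<theta>) auto
    have "F_realises F (tr 0 d \<theta>) \<phi>" if e: "realises e \<phi>" "behaviour_of d = run e" for e d
    proof -
      have "\<exists>q. run (tr 0 d \<theta>) u s = Some q \<and> F_realises_beh F (run q) b"
        if s: "F_realises_beh F (run s) a" for s u
      proof -
        have "realises (tr 1 (program_desc s) a') a"
          using s Impl \<theta>(2) by (intro from_F) auto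
        then obtain e' where e': "run_ordinary e (tr 1 (program_desc s) a') = Some e'"
            "realises e' b"
          using e(1) Impl by auto
        then have "behaviour_of d u (tr 1 (program_desc s) a') = Some e'" for u
          using run_ordinary_eq_run[OF realises_ordinary[OF e(1)]] e(2) by simp
        then have "run (tr 0 d \<theta>) u s = Some (tr 0 (program_desc e') b')"
          using run_tr_Impl[OF X0(2), of d 0 s a' b'] \<theta>(1) by auto
        then show ?thesis using e'(2) Impl \<theta>(3) by (auto intro!: to_F)
      qed
      then show ?thesis using X0(1) unfolding Impl by (auto simp: F_realises_def)
    qed
    moreover have "realises (tr 1 d \<theta>) \<phi>" if d: "F_realises_beh F (behaviour_of d) \<phi>" for d
    proof -
      obtain X where X: "X \<in> F" "\<And>u s. u \<in> X \<Longrightarrow> F_realises_beh F (run s) a \<Longrightarrow>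
        \<exists>q. behaviour_of d u s = Some q \<and> F_realises_beh F (run q) b"
        using d unfolding Impl by auto
      have "\<exists>e'. run (tr 1 d \<theta>) u s = Some e' \<and> realises e' b" if "realises s a" for s u
      proof -
        have "F_realises_beh F (run (tr 0 (program_desc s) a')) a"
          using that Impl \<theta>(2) by (intro to_F) auto
        note X' = X(2)[OF _ this]
        obtain w v where "w \<in> X" "behaviour_of d w (tr 0 (program_desc s) a') = Some v"
          "run (tr 1 d \<theta>) u s = Some (tr 1 (program_desc v) b')"
          using run_tr_Impl[OF F(2)[OF X(1)], of d 1 s a' b'] X' \<theta>(1) by fastforce
        then show ?thesis using X'[of w] Impl \<theta>(3) by (auto intro!: from_F)
      qed
      then show ?thesis by (simp add: Impl ro)
    qed
    ultimately show ?thesis by blast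
  next
    case (Exists x a)
    then obtain y a' where \<theta>: "\<theta> = Exists y a'" "skeleton a' = skeleton a"
      using less(2) by (cases \<theta>) auto
    have "F_realises F (tr 0 d \<theta>) \<phi>" if e: "realises e \<phi>" "behaviour_of d = run e" for e d
    proof -
      obtain i e' where e': "run_ordinary e 0 = Some i" "run_ordinary e 1 = Some e'"
          "realises e' (inst x i a)"
        using e(1) Exists by auto
      then have d: "behaviour_of d u 0 = Some i" "behaviour_of d u 1 = Some e'" for u
        using run_ordinary_eq_run[OF realises_ordinary[OF e(1)]] e(2) by simp_all
      have "run (tr 0 d \<theta>) u n = Some (if n = 0 then i else tr 0 (program_desc e') a')" for u n
        using run_tr_Exists[OF X0(2), of d 0 y a' n] d \<theta>(1) by auto
      then show ?thesis using e'(3) X0(1) Exists \<theta>(2)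
        by (auto simp: F_realises_def intro!: bexI[of _ X0] to_F)
    qed
    moreover have "realises (tr 1 d \<theta>) \<phi>" if d: "F_realises_beh F (behaviour_of d) \<phi>" for d
    proof -
      obtain X i where X: "X \<in> F" "\<And>u. u \<in> X \<Longrightarrow> behaviour_of d u 0 = Some i \<and>
        (\<exists>q. behaviour_of d u 1 = Some q \<and> F_realises_beh F (run q) (inst x i a))"
        using d unfolding Exists by auto
      have "\<exists>q. (\<forall>u. run (tr 1 d \<theta>) u n = Some (if n = 0 then i else tr 1 (program_desc q) a')) \<and>
          F_realises_beh F (run q) (inst x i a)" for n
        using run_tr_Exists[OF F(2)[OF X(1)], of d 1 y a' n] X(2) \<theta>(1) by fastforce
      from this[of 0] this[of 1] show ?thesis using Exists \<theta>(2)
        by (auto simp: ro intro!: from_F)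
    qed
    ultimately show ?thesis by blast
  next
    case (Forall x a)
    then obtain y a' where \<theta>: "\<theta> = Forall y a'" "skeleton a' = skeleton a"
      using less(2) by (cases \<theta>) auto
    have "F_realises F (tr 0 d \<theta>) \<phi>" if e: "realises e \<phi>" "behaviour_of d = run e" for e d
    proof -
      have "\<exists>q. run (tr 0 d \<theta>) u n = Some q \<and> F_realises_beh F (run q) (inst x n a)" for u n
      proof -
        obtain e' where e': "run_ordinary e n = Some e'" "realises e' (inst x n a)"
          using e(1) Forall by auto
        then have "behaviour_of d u n = Some e'" for u
          using run_ordinary_eq_run[OF realises_ordinary[OF e(1)]] e(2) by simp
        then have "run (tr 0 d \<theta>) u n = Some (tr 0 (program_desc e') a')"
          using run_tr_Forall[OF X0(2), of d n 0 y a'] \<theta>(1) by auto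
        then show ?thesis using e'(2) Forall \<theta>(2) by (auto intro!: to_F)
      qed
      then show ?thesis using X0(1) unfolding Forall by (auto simp: F_realises_def)
    qed
    moreover have "realises (tr 1 d \<theta>) \<phi>" if d: "F_realises_beh F (behaviour_of d) \<phi>" for d
    proof -
      obtain X where X: "X \<in> F" "\<And>u n. u \<in> X \<Longrightarrow>
        \<exists>q. behaviour_of d u n = Some q \<and> F_realises_beh F (run q) (inst x n a)"
        using d unfolding Forall by auto
      have "\<exists>e'. run (tr 1 d \<theta>) u n = Some e' \<and> realises e' (inst x n a)" for n u
      proof -
        obtain w v where "w \<in> X" "behaviour_of d w n = Some v"
          "run (tr 1 d \<theta>) u n = Some (tr 1 (program_desc v) a')"
          using run_tr_Forall[OF F(2)[OF X(1)], of d n 1 y a'] X(2) \<theta>(1) by fastforce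
        then show ?thesis using X(2)[of w n] Forall \<theta>(2) by (auto intro!: from_F)
      qed
      then show ?thesis by (simp add: Forall ro)
    qed
    ultimately show ?thesis by blast
  qed
qed

section \<open>Families of co-interval-free sets\<close>

lemma co_interval_free_UNIV: "co_interval_free UNIV"
proof -
  have "(\<lambda>i. i < length s \<and> s ! i) \<in> cylinder s" for s
    by (simp add: cylinder_def)
  then show ?thesis by (auto simp: co_interval_free_def interval_free_def)
qed

lemma open_cylinder: "open (cylinder s)"
proof -
  have "open {f. \<forall>i\<in>{..<length s}. f (id i) \<in> {s ! i}}"
    by (rule product_topology_basis') (auto intro: discrete_topology_class.open_discrete)
  then show ?thesis by (simp add: cylinder_def lessThan_iff Ball_def)
qed

text \<open>A cylinder inside the meagre complement would be a nonempty open subset of a countable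
  union of closed sets with empty interior. Baire's theorem excludes this; it applies because Cantor
  space is compact and regular.\<close>

lemma comeagre_co_interval_free:
  assumes "comeagre X"
  shows "co_interval_free X"
proof -
  obtain B :: "nat \<Rightarrow> cantor set" where B: "\<And>n. nowhere_dense (B n)" "- X = (\<Union>n. B n)"
    using assms by (auto simp: comeagre_def meagre_def)
  have discrete: "(euclidean :: bool topology) = discrete_topology UNIV"
    by (simp add: topology_eq discrete_topology_class.open_discrete)
  have cantor: "(euclidean :: cantor topology) = product_topology (\<lambda>_. discrete_topology UNIV) UNIV"
    using euclidean_product_topology[where 'a = nat and 'b = bool] by (simp add: discrete)
  have "compact_space (euclidean :: cantor topology)" "regular_space (euclidean :: cantor topology)"
    unfolding cantor
    by (simp_all add: compact_space_product_topology compact_space_discrete_topology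
        regular_space_product_topology regular_space_discrete_topology)
  then have "euclidean interior_of \<Union> (range (\<lambda>n. closure (B n))) = {}"
    using B(1) by (intro Baire_category_alt)
      (auto simp: nowhere_dense_def compact_imp_locally_compact_space)
  then have *: "interior (\<Union>n. closure (B n)) = {}" by simp
  have "\<not> cylinder s \<subseteq> - X" for s
  proof
    assume "cylinder s \<subseteq> - X"
    also have "\<dots> \<subseteq> (\<Union>n. closure (B n))" unfolding B(2) using closure_subset by blast
    finally have "cylinder s \<subseteq> {}" using interior_maximal[OF _ open_cylinder] * by metis
    moreover have "cylinder s \<noteq> {}"
      using co_interval_free_UNIV by (auto simp: co_interval_free_def interval_free_def)
    ultimately show False by simp
  qed
  then show ?thesis by (simp add: co_interval_free_def interval_free_def)
qed

text \<open>A cylinder given by \<open>n\<close> bits has measure (1/2)^n, so together with a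
  disjoint set of measure 1 it would exceed the total. The sum is formed in the completion, where
  \<open>X\<close> is measurable.\<close>

lemma measure_one_co_interval_free:
  assumes "X \<in> F_measure_one"
  shows "co_interval_free X"
proof -
  define M where "M = (\<Pi>\<^sub>M i\<in>(UNIV::nat set). measure_pmf (bernoulli_pmf (1/2)))"
  interpret P: product_prob_space "\<lambda>_::nat. measure_pmf (bernoulli_pmf (1/2))" UNIV ..
  interpret C: prob_space "completion M"
    unfolding M_def by (rule prob_spaceI) (simp add: P.emeasure_space_1)
  have C: "cantor_measure = completion M" by (simp add: cantor_measure_def M_def)
  have X: "X \<in> sets (completion M)" "C.prob X = 1"
    using assms by (auto simp: F_measure_one_def C C.emeasure_eq_measure)
  have "\<not> cylinder s \<subseteq> - X" for s
  proof
    assume s: "cylinder s \<subseteq> - X"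
    have eq: "{x \<in> space M. \<forall>i\<in>{..<length s}. x i \<in> {s ! i}} = cylinder s"
      by (auto simp: M_def space_PiM cylinder_def)
    have "emeasure M (cylinder s) = (\<Prod>i<length s. emeasure (measure_pmf (bernoulli_pmf (1/2))) {s
        ! i})"
      unfolding eq[symmetric] M_def by (rule P.emeasure_PiM_Collect) auto
    also have "\<dots> = (\<Prod>i<length s. ennreal (1/2))"
      by (intro prod.cong refl) (simp add: emeasure_pmf_single pmf_bernoulli_half)
    finally have "emeasure M (cylinder s) \<noteq> 0"
      by (simp add: prod_ennreal)
    moreover have sets: "cylinder s \<in> sets M"
    proof -
      have "(\<lambda>x. x i) -` {s ! i} \<inter> space M \<in> sets M" for i
        unfolding M_def by (rule measurable_sets[OF measurable_component_singleton]) auto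
      then have "{x \<in> space M. x i \<in> {s ! i}} \<in> sets M" for i
        by (simp add: vimage_def Int_def conj_commute)
      then show ?thesis
        unfolding eq[symmetric] by (intro sets.sets_Collect_finite_All) auto
    qed
    ultimately have "emeasure (completion M) (cylinder s) \<noteq> 0" by simp
    then have "C.prob (cylinder s) > 0"
      unfolding C.emeasure_eq_measure using zero_less_measure_iff by fastforce
    moreover have "C.prob (cylinder s \<union> X) = C.prob (cylinder s) + C.prob X"
      using s X sets by (intro C.finite_measure_Union) auto
    moreover have "C.prob (cylinder s \<union> X) \<le> 1" by simp
    ultimately show False using X by linarith
  qed
  then show ?thesis by (simp add: co_interval_free_def interval_free_def)
qed

text \<open>Over an empty family no implication and no quantified sentence would be realised, so the
  correspondence requires a member; the whole space serves in all three cases.\<close>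

lemma families_nonempty: "UNIV \<in> F_cif" "UNIV \<in> F_comeagre" "UNIV \<in> F_measure_one"
proof -
  show "UNIV \<in> F_cif" by (simp add: F_cif_def co_interval_free_UNIV)
  have "nowhere_dense ({} :: cantor set)" by (simp add: nowhere_dense_def)
  then show "UNIV \<in> F_comeagre"
    by (auto simp: F_comeagre_def comeagre_def meagre_def intro!: exI[of _ "\<lambda>_. {}"])
  interpret P: product_prob_space "\<lambda>_::nat. measure_pmf (bernoulli_pmf (1/2))" UNIV ..
  interpret C: prob_space cantor_measure
    unfolding cantor_measure_def by (rule prob_spaceI) (simp add: P.emeasure_space_1)
  have "space cantor_measure = UNIV"
    by (simp add: cantor_measure_def space_PiM)
  then show "UNIV \<in> F_measure_one"
    using C.emeasure_space_1 sets.top[of cantor_measure] by (simp add: F_measure_one_def)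
qed

theorem theorem6:
  shows
    "(\<forall>F :: cantor set set. F \<noteq> {} \<and> (\<forall>X\<in>F. co_interval_free X) \<longrightarrow>
        (\<exists>P Pinv. ordinary P \<and> ordinary Pinv \<and>
           (\<forall>\<phi> p. sentence \<phi> \<longrightarrow>
              (realises p \<phi> \<longrightarrow>
                 (\<exists>q. run_ordinary P (prod_encode (p, fm_code \<phi>)) = Some q \<and> F_realises F q \<phi>)) \<and>
              (F_realises F p \<phi> \<longrightarrow>
                 (\<exists>q. run_ordinary Pinv (prod_encode (p, fm_code \<phi>)) = Some q \<and> realises q \<phi>)))) \<and>
        (\<forall>\<phi>. sentence \<phi> \<longrightarrow> (realisable \<phi> \<longleftrightarrow> F_realisable F \<phi>))) \<and>
     (\<forall>\<phi>. sentence \<phi> \<longrightarrow>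
        (realisable \<phi> \<longleftrightarrow> F_realisable F_cif \<phi>) \<and>
        (F_realisable F_cif \<phi> \<longleftrightarrow> F_realisable F_comeagre \<phi>) \<and>
        (F_realisable F_comeagre \<phi> \<longleftrightarrow> F_realisable F_measure_one \<phi>))"
proof -
  obtain c where "translator c" using ex_translator by blast
  then interpret translator c .
  \<comment> \<open>Tag 7 selects the entry point of the translator. The description 0 is a
    placeholder, as the realiser arrives with the input. No family has been fixed yet: the same pair
    of programs serves all of them.\<close>
  define P where "P = translate c 0 0 (prod_encode (7, 0))"
  define Pinv where "Pinv = translate c 1 0 (prod_encode (7, 0))"
  have ord: "ordinary P" "ordinary Pinv"
    by (simp_all add: P_def Pinv_def ordinary_translate)
  have run: "run_ordinary P (prod_encode (p, fm_code \<phi>)) = Some (tr 0 (program_desc p) \<phi>)"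
    "run_ordinary Pinv (prod_encode (p, fm_code \<phi>)) = Some (tr 1 (program_desc p) \<phi>)" for p \<phi>
    by (simp_all only: run_ordinary_def P_def Pinv_def run_entry)
  have correct: "realises p \<phi> \<Longrightarrow> F_realises F (tr 0 (program_desc p) \<phi>) \<phi>"
    "F_realises F p \<phi> \<Longrightarrow> realises (tr 1 (program_desc p) \<phi>) \<phi>"
    if "F \<noteq> {}" "\<And>X. X \<in> F \<Longrightarrow> co_interval_free X" for F p \<phi>
  proof -
    note c = tr_correct[where F = F, OF that refl, of \<phi>]
    from c show "realises p \<phi> \<Longrightarrow> F_realises F (tr 0 (program_desc p) \<phi>) \<phi>"
      using behaviour_of_program_desc by blast
    from c show "F_realises F p \<phi> \<Longrightarrow> realises (tr 1 (program_desc p) \<phi>) \<phi>"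
      unfolding F_realises_def by (metis behaviour_of_program_desc)
  qed
  have iff: "realisable \<phi> \<longleftrightarrow> F_realisable F \<phi>"
    if "F \<noteq> {}" "\<And>X. X \<in> F \<Longrightarrow> co_interval_free X" for F \<phi>
    unfolding realisable_def F_realisable_def using correct[OF that] by blast
  have "realisable \<phi> \<longleftrightarrow> F_realisable F_cif \<phi>" for \<phi>
    by (rule iff) (use families_nonempty(1) in \<open>auto simp: F_cif_def\<close>)
  moreover have "realisable \<phi> \<longleftrightarrow> F_realisable F_comeagre \<phi>" for \<phi>
    by (rule iff) (use families_nonempty(2) in \<open>auto simp: F_comeagre_def
        comeagre_co_interval_free\<close>)
  moreover have "realisable \<phi> \<longleftrightarrow> F_realisable F_measure_one \<phi>" for \<phi>
    by (rule iff) (use families_nonempty(3) in \<open>auto simp: measure_one_co_interval_free\<close>)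
  ultimately have families: "\<forall>\<phi>. sentence \<phi> \<longrightarrow>
        (realisable \<phi> \<longleftrightarrow> F_realisable F_cif \<phi>) \<and>
        (F_realisable F_cif \<phi> \<longleftrightarrow> F_realisable F_comeagre \<phi>) \<and>
        (F_realisable F_comeagre \<phi> \<longleftrightarrow> F_realisable F_measure_one \<phi>)"
    by simp
  show ?thesis
  proof (rule conjI[OF _ families], intro allI impI, elim conjE, rule conjI)
    fix F :: "cantor set set"
    assume F: "F \<noteq> {}" "\<forall>X\<in>F. co_interval_free X"
    then show "\<forall>\<phi>. sentence \<phi> \<longrightarrow> realisable \<phi> \<longleftrightarrow> F_realisable F \<phi>"
      using iff[of F] by simp
    show "\<exists>P Pinv. ordinary P \<and> ordinary Pinv \<and>
           (\<forall>\<phi> p. sentence \<phi> \<longrightarrow>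
              (realises p \<phi> \<longrightarrow>
                 (\<exists>q. run_ordinary P (prod_encode (p, fm_code \<phi>)) = Some q \<and> F_realises F q \<phi>)) \<and>
              (F_realises F p \<phi> \<longrightarrow>
                 (\<exists>q. run_ordinary Pinv (prod_encode (p, fm_code \<phi>)) = Some q \<and> realises q \<phi>)))"
      by (rule exI[of _ P], rule exI[of _ Pinv]) (use F correct[of F] in \<open>simp add: ord run\<close>)
  qed
qed

end
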